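(* Let $X$ be a mediangle graph. For every hyperplane $J$ of $X$, the graph obtained from $X$ by removing the edges in $J$ has at least two connected components, and each of these components is convex in $X$. Moreover, the distance between any two vertices of $X$ coincides with the number of hyperplanes separating them.
   Context: All graphs are simplicial (no loops, no multiple edges). Subgraphs are identified with sets of vertices endowed with the induced adjacency relation; connected graphs are non-empty. $d$ denotes the graph distance and $I(x,y)=\{z \mid d(x,y)=d(x,z)+d(z,y)\}$. A subgraph $Y$ is convex if $I(x,y)\subset Y$ for all $x,y\in Y$. A convex cycle is a convex subgraph isomorphic to a cycle. A connected graph $X$ is mediangle if: (Triangle Condition) for all vertices $o,x,y$ with $d(o,x)=d(o,y)$ and $d(x,y)=1$, there is a common neighbour $z$ of $x,y$ with $z\in I(o,x)\cap I(o,y)$; (Intersection of Triangles) $X$ contains no induced copy of $K_4^-$ (the complete graph $K_4$ minus an edge); (Cycle Condition) for all vertices $o,x,y,z$ with $x\neq y$, $d(o,x)=d(o,y)=d(o,z)-1$ and $d(x,z)=d(y,z)=1$, there is a convex cycle of even length containing the edges $[z,x],[z,y]$ such that the vertex opposite to $z$ in it belongs to $I(o,x)\cap I(o,y)$; (Intersection of Even Cycles) the intersection of any two distinct convex cycles of even lengths contains at most one edge. A hyperplane of $X$ is an equivalence class of edges with respect to the transitive closure of the relation that identifies two edges whenever they belong to a common $3$-cycle or are opposite in a convex cycle of even length. A hyperplane $J$ separates two vertices if they lie in distinct connected components of the graph obtained from $X$ by removing (only) the edges in $J$. *)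

theory Defs
  imports Main
begin

text \<open>
  A graph is given by a (possibly infinite) set \<open>V\<close> of vertices and a set \<open>E\<close> of edges, each
  edge being an unordered pair \<open>{x, y}\<close> of distinct vertices.
\<close>

definition simple_graph :: "'a set \<Rightarrow> 'a set set \<Rightarrow> bool" where
  "simple_graph V E \<longleftrightarrow> (\<forall>e\<in>E. \<exists>x\<in>V. \<exists>y\<in>V. x \<noteq> y \<and> e = {x, y})"

definition adj :: "'a set set \<Rightarrow> ('a \<times> 'a) set" where
  "adj E = {(x, y). {x, y} \<in> E}"

definition graph_connected :: "'a set \<Rightarrow> 'a set set \<Rightarrow> bool" where
  "graph_connected V E \<longleftrightarrow> V \<noteq> {} \<and> (\<forall>x\<in>V. \<forall>y\<in>V. (x, y) \<in> (adj E)\<^sup>*)"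

definition graph_components :: "'a set \<Rightarrow> 'a set set \<Rightarrow> 'a set set" where
  "graph_components V E = V // {(x, y). x \<in> V \<and> y \<in> V \<and> (x, y) \<in> (adj E)\<^sup>*}"

text \<open>
  The length of a shortest walk. The value is unspecified for vertices in different components;
  distances are only taken in connected graphs.
\<close>

definition graph_dist :: "'a set set \<Rightarrow> 'a \<Rightarrow> 'a \<Rightarrow> nat" where
  "graph_dist E x y = (LEAST n. (x, y) \<in> (adj E) ^^ n)"

definition graph_interval :: "'a set \<Rightarrow> 'a set set \<Rightarrow> 'a \<Rightarrow> 'a \<Rightarrow> 'a set" where
  "graph_interval V E x y = {z \<in> V. graph_dist E x y = graph_dist E x z + graph_dist E z y}"

definition graph_convex :: "'a set \<Rightarrow> 'a set set \<Rightarrow> 'a set \<Rightarrow> bool" where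
  "graph_convex V E Y \<longleftrightarrow> Y \<subseteq> V \<and> (\<forall>x\<in>Y. \<forall>y\<in>Y. graph_interval V E x y \<subseteq> Y)"

definition induced_edges :: "'a set set \<Rightarrow> 'a set \<Rightarrow> 'a set set" where
  "induced_edges E Y = {e \<in> E. e \<subseteq> Y}"

definition graph_iso ::
  "'a set \<Rightarrow> 'a set set \<Rightarrow> 'b set \<Rightarrow> 'b set set \<Rightarrow> ('a \<Rightarrow> 'b) \<Rightarrow> bool" where
  "graph_iso V E V' E' f \<longleftrightarrow>
     bij_betw f V V' \<and> (\<forall>x\<in>V. \<forall>y\<in>V. {x, y} \<in> E \<longleftrightarrow> {f x, f y} \<in> E')"

definition cycle_edges :: "nat \<Rightarrow> nat set set" where
  "cycle_edges n = {{i, Suc i mod n} | i. i < n}"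

definition K4_minus_edges :: "nat set set" where
  "K4_minus_edges = {{0, 1}, {0, 2}, {0, 3}, {1, 2}, {1, 3}}"

text \<open>
  \<open>cycle_labelling E Y n c\<close>: the subgraph induced on \<open>Y\<close> is the cycle
  \<open>c 0, c 1, \<dots>, c (n - 1), c 0\<close> of length \<open>n\<close>.
\<close>

definition cycle_labelling :: "'a set set \<Rightarrow> 'a set \<Rightarrow> nat \<Rightarrow> (nat \<Rightarrow> 'a) \<Rightarrow> bool" where
  "cycle_labelling E Y n c \<longleftrightarrow>
     n \<ge> 3 \<and> graph_iso {..<n} (cycle_edges n) Y (induced_edges E Y) c"

definition three_cycle :: "'a set \<Rightarrow> 'a set set \<Rightarrow> 'a set \<Rightarrow> bool" where
  "three_cycle V E Y \<longleftrightarrow> Y \<subseteq> V \<and> (\<exists>c. cycle_labelling E Y 3 c)"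

definition convex_even_cycle :: "'a set \<Rightarrow> 'a set set \<Rightarrow> 'a set \<Rightarrow> bool" where
  "convex_even_cycle V E Y \<longleftrightarrow>
     graph_convex V E Y \<and> (\<exists>n c. even n \<and> cycle_labelling E Y n c)"

definition opposite_vertices :: "'a set set \<Rightarrow> 'a set \<Rightarrow> 'a \<Rightarrow> 'a \<Rightarrow> bool" where
  "opposite_vertices E Y u v \<longleftrightarrow>
     (\<exists>n c i. even n \<and> cycle_labelling E Y n c \<and> i < n \<and>
        u = c i \<and> v = c ((i + n div 2) mod n))"

definition opposite_edges :: "'a set set \<Rightarrow> 'a set \<Rightarrow> 'a set \<Rightarrow> 'a set \<Rightarrow> bool" where
  "opposite_edges E Y e f \<longleftrightarrow>
     (\<exists>n c i. even n \<and> cycle_labelling E Y n c \<and> i < n \<and>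
        e = {c i, c (Suc i mod n)} \<and>
        f = {c ((i + n div 2) mod n), c (Suc (i + n div 2) mod n)})"

definition triangle_condition :: "'a set \<Rightarrow> 'a set set \<Rightarrow> bool" where
  "triangle_condition V E \<longleftrightarrow>
     (\<forall>p\<in>V. \<forall>x\<in>V. \<forall>y\<in>V. graph_dist E p x = graph_dist E p y \<and> graph_dist E x y = 1 \<longrightarrow>
        (\<exists>z\<in>V. {z, x} \<in> E \<and> {z, y} \<in> E \<and> z \<in> graph_interval V E p x \<inter> graph_interval V E p y))"

definition intersection_of_triangles :: "'a set \<Rightarrow> 'a set set \<Rightarrow> bool" where
  "intersection_of_triangles V E \<longleftrightarrow>
     \<not> (\<exists>Y f. Y \<subseteq> V \<and> graph_iso {..<4} K4_minus_edges Y (induced_edges E Y) f)"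

definition cycle_condition :: "'a set \<Rightarrow> 'a set set \<Rightarrow> bool" where
  "cycle_condition V E \<longleftrightarrow>
     (\<forall>p\<in>V. \<forall>x\<in>V. \<forall>y\<in>V. \<forall>z\<in>V.
        x \<noteq> y \<and> graph_dist E p x = graph_dist E p y \<and> graph_dist E p z = graph_dist E p y + 1 \<and>
        graph_dist E x z = 1 \<and> graph_dist E y z = 1 \<longrightarrow>
        (\<exists>Y w. convex_even_cycle V E Y \<and> {{z, x}, {z, y}} \<subseteq> induced_edges E Y \<and>
           opposite_vertices E Y z w \<and> w \<in> graph_interval V E p x \<inter> graph_interval V E p y))"

definition intersection_of_even_cycles :: "'a set \<Rightarrow> 'a set set \<Rightarrow> bool" where
  "intersection_of_even_cycles V E \<longleftrightarrow>
     (\<forall>Y Z. convex_even_cycle V E Y \<and> convex_even_cycle V E Z \<and> Y \<noteq> Z \<longrightarrow>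
        (\<forall>e \<in> induced_edges E (Y \<inter> Z). \<forall>f \<in> induced_edges E (Y \<inter> Z). e = f))"

definition mediangle :: "'a set \<Rightarrow> 'a set set \<Rightarrow> bool" where
  "mediangle V E \<longleftrightarrow>
     simple_graph V E \<and> graph_connected V E \<and>
     triangle_condition V E \<and> intersection_of_triangles V E \<and>
     cycle_condition V E \<and> intersection_of_even_cycles V E"

definition elementary_parallel :: "'a set \<Rightarrow> 'a set set \<Rightarrow> ('a set \<times> 'a set) set" where
  "elementary_parallel V E = {(e, f).
     (\<exists>Y. three_cycle V E Y \<and> e \<in> induced_edges E Y \<and> f \<in> induced_edges E Y) \<or>
     (\<exists>Y. convex_even_cycle V E Y \<and> opposite_edges E Y e f)}"

text \<open>
  The closure is taken reflexive on \<open>E\<close>, so that an edge that lies in no 3-cycle and in no convex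
  even cycle (as in a tree) forms a hyperplane by itself.
\<close>

definition hyperplanes :: "'a set \<Rightarrow> 'a set set \<Rightarrow> 'a set set set" where
  "hyperplanes V E = E // {(e, f). e \<in> E \<and> f \<in> E \<and> (e, f) \<in> (elementary_parallel V E)\<^sup>*}"

definition separates :: "'a set \<Rightarrow> 'a set set \<Rightarrow> 'a set set \<Rightarrow> 'a \<Rightarrow> 'a \<Rightarrow> bool" where
  "separates V E J x y \<longleftrightarrow>
     (\<exists>C \<in> graph_components V (E - J). \<exists>D \<in> graph_components V (E - J).
        C \<noteq> D \<and> x \<in> C \<and> y \<in> D)"

end

theory Submission
  imports Defs
begin

text \<open>
  An edge \<open>a b\<close> lies in a unique maximal clique, and the triangle condition together with the absence
  of induced \<open>K\<^sub>4\<^sup>-\<close> makes every vertex \<open>p\<close> have a unique nearest vertex, its gate, in that clique.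
  The hyperplane of \<open>a b\<close> turns out to consist exactly of the edges whose two ends have different
  gates: having ends with different gates is preserved by both kinds of elementary
  parallelism, and conversely such an edge can be pushed, along opposite edges of convex even
  cycles, until it lies in the clique. Both directions rest on one metric fact: for a convex cycle
  of length \<open>2n\<close> and a vertex \<open>p\<close>, the sum of the distances from \<open>p\<close> to two opposite vertices does not
  depend on the pair. This follows from the cycle condition at a strict maximum of the distance to
  \<open>p\<close>; if there is none, some edge of the cycle has both ends at the same distance, hence
  carries a triangle, which forces the cycle to have length 4, the side of a prism.

  A geodesic crosses a hyperplane at most once: from its first edge \<open>a b\<close> in the hyperplane on, all
  its vertices have gate \<open>b\<close>.
\<close>

section \<open>Adjacency of cycle labels as divisibility\<close>

lemma cycle_edges_iff:
  assumes "i < n" "j < n"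
  shows "{i, j} \<in> cycle_edges n \<longleftrightarrow> j = Suc i mod n \<or> i = Suc j mod n"
  using assms unfolding cycle_edges_def by (auto simp: doubleton_eq_iff)

lemma residue_eq_iff:
  assumes "int a = i mod int n" "int b = j mod int n"
  shows "a = b \<longleftrightarrow> int n dvd i - j"
  using assms by (metis mod_eq_dvd_iff of_nat_eq_iff)

lemma residue_Suc_iff:
  assumes "int a = i mod int n" "int b = j mod int n"
  shows "b = Suc a mod n \<longleftrightarrow> int n dvd j - i - 1"
proof -
  have "int (Suc a mod n) = (i + 1) mod int n"
    using assms(1) by (simp add: zmod_int mod_simps add.commute)
  then have "b = Suc a mod n \<longleftrightarrow> j mod int n = (i + 1) mod int n"
    using assms(2) by (metis of_nat_eq_iff)
  then show ?thesis by (simp add: mod_eq_dvd_iff diff_diff_eq)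
qed

section \<open>Graph distance and the triangle axioms in terms of edges\<close>

locale mediangle_graph =
  fixes V :: "'a set" and E :: "'a set set"
  assumes mediangle: "mediangle V E"
begin

abbreviation dist :: "'a \<Rightarrow> 'a \<Rightarrow> nat" where
  "dist \<equiv> graph_dist E"

abbreviation edge :: "'a \<Rightarrow> 'a \<Rightarrow> bool" where
  "edge x y \<equiv> {x, y} \<in> E"

lemma edge_sym: "edge x y \<Longrightarrow> edge y x"
  by (simp add: insert_commute)

lemma edge_props: "edge x y \<Longrightarrow> x \<in> V \<and> y \<in> V \<and> x \<noteq> y"
  using mediangle unfolding mediangle_def simple_graph_def
  by (metis doubleton_eq_iff)

lemma edgeE:
  assumes "e \<in> E" obtains x y where "e = {x, y}" "edge x y"
proof -
  have "\<exists>x\<in>V. \<exists>y\<in>V. x \<noteq> y \<and> e = {x, y}"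
    using assms mediangle unfolding mediangle_def simple_graph_def by (metis (lifting))
  then show thesis using that assms by (metis (lifting))
qed

lemma walk_sym: "(x, y) \<in> (adj E) ^^ n \<Longrightarrow> (y, x) \<in> (adj E) ^^ n"
proof (induction n arbitrary: y)
  case (Suc n)
  then obtain z where "(x, z) \<in> (adj E) ^^ n" "(z, y) \<in> adj E" by auto
  then have "(z, x) \<in> (adj E) ^^ n" "(y, z) \<in> adj E"
    using Suc.IH by (auto simp: adj_def insert_commute)
  then show ?case by (meson relpow_Suc_I2)
qed auto

lemma walk_exists: "x \<in> V \<Longrightarrow> y \<in> V \<Longrightarrow> \<exists>n. (x, y) \<in> (adj E) ^^ n"
  using mediangle unfolding mediangle_def graph_connected_def
  by (meson rtrancl_imp_relpow)

lemma dist_walk: "x \<in> V \<Longrightarrow> y \<in> V \<Longrightarrow> (x, y) \<in> (adj E) ^^ dist x y"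
  unfolding graph_dist_def by (rule LeastI_ex[OF walk_exists])

lemma dist_le: "(x, y) \<in> (adj E) ^^ n \<Longrightarrow> dist x y \<le> n"
  unfolding graph_dist_def by (rule Least_le)

lemma dist_sym: "dist x y = dist y x"
proof -
  have "(x, y) \<in> (adj E) ^^ n \<longleftrightarrow> (y, x) \<in> (adj E) ^^ n" for n using walk_sym by blast
  then show ?thesis by (simp add: graph_dist_def)
qed

lemma dist_triangle:
  assumes "x \<in> V" "y \<in> V" "z \<in> V" shows "dist x z \<le> dist x y + dist y z"
  by (rule dist_le[OF relpow_trans[OF dist_walk[OF assms(1,2)] dist_walk[OF assms(2,3)]]])

lemma dist_self [simp]: "dist x x = 0"
  using dist_le[of x x 0] by simp

lemma dist_eq_0: "x \<in> V \<Longrightarrow> y \<in> V \<Longrightarrow> dist x y = 0 \<longleftrightarrow> x = y"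
  using dist_walk[of x y] by auto

lemma dist_edge: "edge x y \<Longrightarrow> dist x y = 1"
  using dist_le[of x y 1] dist_eq_0[of x y] edge_props[of x y]
  by (auto simp: adj_def)

lemma dist_eq_1: "x \<in> V \<Longrightarrow> y \<in> V \<Longrightarrow> dist x y = 1 \<longleftrightarrow> edge x y"
  using dist_walk[of x y] dist_edge by (auto simp: adj_def)

lemma dist_edge_le:
  assumes "p \<in> V" "edge x y" shows "dist p y \<le> dist p x + 1"
  using dist_triangle[of p x y] dist_edge[OF assms(2)] edge_props[OF assms(2)] assms by auto

lemma dist_edge_ge:
  assumes "p \<in> V" "edge x y" shows "dist p x \<le> dist p y + 1"
  using dist_edge_le[OF assms(1) edge_sym[OF assms(2)]] .

lemma pred_exists:
  assumes "x \<in> V" "y \<in> V" "dist x y = Suc k"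
  obtains z where "edge z y" "dist x z = k"
proof -
  have "(x, y) \<in> (adj E) ^^ Suc k" using dist_walk assms by metis
  then obtain z where z: "(x, z) \<in> (adj E) ^^ k" "(z, y) \<in> adj E" by auto
  have e: "edge z y" using z(2) by (simp add: adj_def)
  have "dist x z \<le> k" using z(1) dist_le by blast
  moreover have "Suc k \<le> dist x z + 1" using dist_edge_le[OF assms(1) e] assms(3) by simp
  ultimately show thesis using that[OF e] by simp
qed

lemma triangle_cond:
  assumes "p \<in> V" "edge x y" "dist p x = dist p y"
  obtains z where "edge z x" "edge z y" "dist p x = dist p z + 1"
proof -
  have xy: "x \<in> V" "y \<in> V" "dist x y = 1" using edge_props[OF assms(2)] dist_edge[OF assms(2)] by auto
  obtain z where z: "edge z x" "edge z y" "z \<in> graph_interval V E p x"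
    using mediangle assms xy unfolding mediangle_def triangle_condition_def by blast
  then show thesis using that dist_edge[of z x] by (auto simp: graph_interval_def)
qed

text \<open>This is how the absence of induced \<open>K4_minus_edges\<close> is used: otherwise
  \<open>z\<close>, \<open>w\<close> would be the only non-adjacent pair among the four
  vertices.\<close>

lemma no_K4_minus:
  assumes "edge x y" "edge z x" "edge z y" "edge w x" "edge w y" "z \<noteq> w"
  shows "edge z w"
proof (rule ccontr)
  assume nzw: "\<not> edge z w"
  \<comment> \<open>Labels 2 and 3 form the missing edge of \<open>K4_minus_edges\<close>, so
    \<open>z\<close> and \<open>w\<close> receive them.\<close>
  define f where "f = (\<lambda>i::nat. if i = 0 then x else if i = 1 then y else if i = 2 then z else w)"
  let ?Y = "{x, y, z, w}"
  have ne: "x \<noteq> y" "x \<noteq> z" "y \<noteq> z" "x \<noteq> w" "y \<noteq> w" "x \<in> V" "y \<in> V" "z \<in> V" "w \<in> V"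
    using assms edge_props by metis+
  have four: "{..<4} = {0, 1, 2, 3::nat}" by auto
  have loop: "{v} \<notin> E" for v using edge_props[of v v] by auto
  have "bij_betw f {..<4} ?Y"
    unfolding bij_betw_def four using ne assms(6) by (auto simp: f_def inj_on_def)
  moreover have "\<forall>i\<in>{..<4}. \<forall>j\<in>{..<4}. {i, j} \<in> K4_minus_edges \<longleftrightarrow> {f i, f j} \<in> induced_edges E ?Y"
    unfolding four using assms nzw loop
    by (auto simp: f_def K4_minus_edges_def induced_edges_def doubleton_eq_iff insert_commute)
  ultimately have "graph_iso {..<4} K4_minus_edges ?Y (induced_edges E ?Y) f"
    by (simp add: graph_iso_def)
  then show False using mediangle ne unfolding mediangle_def intersection_of_triangles_def
    by (metis empty_subsetI insert_subset)
qed

section \<open>Convex even cycles\<close>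

text \<open>
  A convex cycle of length \<open>2n\<close>, labelled periodically by the integers, so that the labelling can
  be shifted and reflected freely.
\<close>

definition even_cycle :: "nat \<Rightarrow> (int \<Rightarrow> 'a) \<Rightarrow> bool" where
  "even_cycle n f \<longleftrightarrow> n \<ge> 2 \<and> graph_convex V E (range f) \<and>
     (\<forall>i j. f i = f j \<longleftrightarrow> 2 * int n dvd i - j) \<and>
     (\<forall>i j. edge (f i) (f j) \<longleftrightarrow> 2 * int n dvd j - i - 1 \<or> 2 * int n dvd i - j - 1)"

lemma even_cycle_shift:
  assumes "even_cycle n f" shows "even_cycle n (\<lambda>i. f (i + k))"
proof -
  have "range (\<lambda>i. f (i + k)) = range f"
    by (auto simp: image_iff) (metis diff_add_cancel)
  then show ?thesis using assms unfolding even_cycle_def by (simp add: algebra_simps)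
qed

lemma even_cycle_reflect:
  assumes "even_cycle n f" shows "even_cycle n (\<lambda>i. f (k - i))"
proof -
  have r: "range (\<lambda>i. f (k - i)) = range f"
    by (auto simp: image_iff) (metis diff_diff_eq2 add_diff_cancel_left')
  have 1: "f (k - i) = f (k - j) \<longleftrightarrow> 2 * int n dvd i - j" for i j
    using assms unfolding even_cycle_def by (simp add: dvd_diff_commute)
  have 2: "edge (f (k - i)) (f (k - j)) \<longleftrightarrow> 2 * int n dvd j - i - 1 \<or> 2 * int n dvd i - j - 1" for i j
    using assms unfolding even_cycle_def by (auto simp: algebra_simps)
  show ?thesis using assms r 1 2 unfolding even_cycle_def by simp
qed

context
  fixes n f assumes cyc: "even_cycle n f"
begin

lemma cycle_length: "n \<ge> 2" using cyc unfolding even_cycle_def by simp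

lemma cycle_convex: "graph_convex V E (range f)" using cyc unfolding even_cycle_def by simp

lemma cycle_V: "f i \<in> V" using cycle_convex unfolding graph_convex_def by auto

lemma cycle_eq: "f i = f j \<longleftrightarrow> 2 * int n dvd i - j" using cyc unfolding even_cycle_def by simp

lemma cycle_edge: "edge (f i) (f j) \<longleftrightarrow> 2 * int n dvd j - i - 1 \<or> 2 * int n dvd i - j - 1"
  using cyc unfolding even_cycle_def by simp

lemma cycle_edge_Suc: "edge (f i) (f (i + 1))" by (simp add: cycle_edge)

lemma cycle_neighbour:
  assumes "edge (f i) (f j)" shows "f j = f (i + 1) \<or> f j = f (i - 1)"
proof -
  have "2 * int n dvd i - j - 1 \<longleftrightarrow> 2 * int n dvd j - (i - 1)"
    using dvd_minus_iff[of "2 * int n" "j - (i - 1)"] by (simp add: algebra_simps)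
  then show ?thesis using assms unfolding cycle_edge cycle_eq by (simp add: diff_diff_eq)
qed

lemma cycle_convexD:
  assumes "x \<in> V" "dist (f i) x + dist x (f j) = dist (f i) (f j)" shows "x \<in> range f"
proof -
  have "x \<in> graph_interval V E (f i) (f j)" using assms by (simp add: graph_interval_def)
  moreover have "graph_interval V E (f i) (f j) \<subseteq> range f"
    using cycle_convex unfolding graph_convex_def by (meson rangeI)
  ultimately show ?thesis by (rule rev_subsetD)
qed

lemma cycle_dist_le: "dist (f i) (f (i + int k)) \<le> k"
proof (induction k)
  case (Suc k)
  have "dist (f i) (f (i + int k + 1)) \<le> dist (f i) (f (i + int k)) + 1"
    by (rule dist_edge_le[OF cycle_V cycle_edge_Suc])
  also have "i + int k + 1 = i + int (Suc k)" by simp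
  finally show ?case using Suc.IH by linarith
qed simp

text \<open>Walk back along a geodesic from \<open>f j\<close> to \<open>f i\<close>: by convexity
  it stays on the cycle, so the label changes by one at each step.\<close>

lemma cycle_dist_ge: "dist (f i) (f j) = k \<Longrightarrow> \<exists>t. \<bar>t\<bar> \<le> int k \<and> f j = f (i + t)"
proof (induction k arbitrary: j)
  case 0
  then have "f j = f i" using dist_eq_0 cycle_V by metis
  then show ?case by (intro exI[of _ 0]) simp
next
  case (Suc k)
  then obtain z where z: "edge z (f j)" "dist (f i) z = k"
    using pred_exists cycle_V by metis
  then have "z \<in> range f" using cycle_convexD[of z i j] Suc.prems dist_edge[OF z(1)] edge_props by auto
  then obtain j' where j': "z = f j'" by auto
  then obtain t where t: "\<bar>t\<bar> \<le> int k" "f j' = f (i + t)" using Suc.IH z by blast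
  have "edge (f (i + t)) (f j)" using t j' z by simp
  from cycle_neighbour[OF this] consider "f j = f (i + (t + 1))" | "f j = f (i + (t - 1))"
    by (auto simp: algebra_simps)
  then show ?case
  proof cases
    case 1 then show ?thesis using t(1) by (intro exI[of _ "t + 1"]) auto
  next
    case 2 then show ?thesis using t(1) by (intro exI[of _ "t - 1"]) auto
  qed
qed

text \<open>A shorter path would reach the same vertex with an offset \<open>t\<close> of absolute
  value below \<open>k\<close>, but then \<open>k - t\<close> lies strictly between 0 and
  \<open>2 * n\<close> and is not a multiple of \<open>2 * n\<close>.\<close>

lemma cycle_dist:
  assumes "k \<le> n" shows "dist (f i) (f (i + int k)) = k"
proof -
  obtain t where t: "\<bar>t\<bar> \<le> int (dist (f i) (f (i + int k)))" "f (i + int k) = f (i + t)"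
    using cycle_dist_ge by blast
  then have "2 * int n dvd int k - t" using cycle_eq by simp
  then obtain s where s: "int k - t = 2 * int n * s" by auto
  have "\<bar>t\<bar> \<ge> int k"
  proof (rule ccontr)
    assume "\<not> \<bar>t\<bar> \<ge> int k"
    then have "0 < int k - t" "int k - t < 2 * int n" using assms by auto
    then show False using s by (metis \<open>2 * int n dvd int k - t\<close> zdvd_not_zless)
  qed
  then show ?thesis using t(1) cycle_dist_le[of i k] by simp
qed

lemma cycle_dist_rev: "k \<le> n \<Longrightarrow> dist (f (i + int k)) (f i) = k"
  using cycle_dist dist_sym by metis

text \<open>Going round the cycle in either direction bounds the distance by \<open>r\<close> and by
  \<open>2 * n - r\<close>, where \<open>r\<close> is the label difference modulo
  \<open>2 * n\<close>; only \<open>r = n\<close> allows distance \<open>n\<close>. So distance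
  alone recognises the antipode.\<close>

lemma cycle_opposite: "dist (f i) (f j) \<ge> n \<Longrightarrow> f j = f (i + int n)"
proof -
  assume a: "dist (f i) (f j) \<ge> n"
  define r where "r = (j - i) mod (2 * int n)"
  have n0: "n > 0" using cycle_length by simp
  have "(j - i) - r = 2 * int n * ((j - i) div (2 * int n))"
    unfolding r_def by (rule minus_mod_eq_mult_div)
  then have "j - (i + r) = 2 * int n * ((j - i) div (2 * int n))" by linarith
  then have fr: "f j = f (i + r)" unfolding cycle_eq by (metis dvd_triv_left)
  have r: "0 \<le> r" "r < 2 * int n" using n0 by (auto simp: r_def)
  consider "r < int n" | "r = int n" | "r > int n" by linarith
  then show ?thesis
  proof cases
    case 1
    then have "dist (f i) (f j) \<le> nat r" using cycle_dist_le[of i "nat r"] r fr by simp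
    then show ?thesis using 1 a r(1) by linarith
  next
    case 2 then show ?thesis using fr by simp
  next
    case 3
    have "f (i + r + int (nat (2 * int n - r))) = f i" unfolding cycle_eq using r by simp
    then have "dist (f j) (f i) \<le> nat (2 * int n - r)"
      using cycle_dist_le[of "i + r" "nat (2 * int n - r)"] fr by simp
    then show ?thesis using 3 a r(2) dist_sym[of "f i" "f j"] by linarith
  qed
qed

lemma cycle_dist_max: "dist (f i) (f j) \<le> n"
proof (rule ccontr)
  assume "\<not> ?thesis"
  then show False using cycle_opposite[of i j] cycle_dist[of n i] by auto
qed

end

text \<open>Reading labels modulo \<open>N\<close> makes the labelling periodic; the half length
  \<open>N div 2\<close> is exact because \<open>N\<close> is even.\<close>

lemma even_cycle_of_labelling:
  assumes "graph_convex V E Y" "cycle_labelling E Y N c" "even N"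
  defines "f \<equiv> \<lambda>i. c (nat (i mod int N))"
  shows "even_cycle (N div 2) f" "range f = Y" "\<And>k. k < N \<Longrightarrow> f (int k) = c k"
proof -
  have bij: "bij_betw c {..<N} Y" and
    iso: "\<And>i j. i < N \<Longrightarrow> j < N \<Longrightarrow> {i, j} \<in> cycle_edges N \<longleftrightarrow> {c i, c j} \<in> induced_edges E Y" and
    N: "N \<ge> 3" using assms(2) unfolding cycle_labelling_def graph_iso_def by auto
  have res: "nat (i mod int N) < N" "int (nat (i mod int N)) = i mod int N" for i
    using N by (auto simp: nat_less_iff)
  show fk: "f (int k) = c k" if "k < N" for k using that by (simp add: f_def)
  show rng: "range f = Y"
  proof
    show "range f \<subseteq> Y" using bij res(1) unfolding bij_betw_def f_def by auto
    show "Y \<subseteq> range f"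
    proof
      fix y assume "y \<in> Y"
      then obtain k where "k < N" "y = c k" using bij unfolding bij_betw_def by auto
      then show "y \<in> range f" using fk by (metis rangeI)
    qed
  qed
  have N2: "2 * int (N div 2) = int N" using assms(3) by auto
  have eq: "f i = f j \<longleftrightarrow> int N dvd i - j" for i j
  proof -
    have "f i = f j \<longleftrightarrow> nat (i mod int N) = nat (j mod int N)"
      using bij res(1) unfolding bij_betw_def f_def inj_on_def by auto
    then show ?thesis using residue_eq_iff[OF res(2) res(2)] by simp
  qed
  have ed: "edge (f i) (f j) \<longleftrightarrow> int N dvd j - i - 1 \<or> int N dvd i - j - 1" for i j
  proof -
    have "edge (f i) (f j) \<longleftrightarrow> {f i, f j} \<in> induced_edges E Y"
      using rng by (auto simp: induced_edges_def)
    also have "\<dots> \<longleftrightarrow> {nat (i mod int N), nat (j mod int N)} \<in> cycle_edges N"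
      using iso[OF res(1) res(1)] by (simp add: f_def)
    also have "\<dots> \<longleftrightarrow> int N dvd j - i - 1 \<or> int N dvd i - j - 1"
      unfolding cycle_edges_iff[OF res(1) res(1)] residue_Suc_iff[OF res(2) res(2)] ..
    finally show ?thesis .
  qed
  have "N div 2 \<ge> 2" using N assms(3) by presburger
  then show "even_cycle (N div 2) f"
    unfolding even_cycle_def N2 using rng assms(1) eq ed by simp
qed

lemma labelling_of_even_cycle:
  assumes cyc: "even_cycle n f"
  shows "cycle_labelling E (range f) (2 * n) (\<lambda>i. f (int i))"
proof -
  have n: "n \<ge> 2" by (rule cycle_length[OF cyc])
  have res: "int k = int k mod int (2 * n)" if "k < 2 * n" for k using that by simp
  have "inj_on (\<lambda>i. f (int i)) {..<2 * n}"
  proof (rule inj_onI)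
    fix i j assume "i \<in> {..<2 * n}" "j \<in> {..<2 * n}" "f (int i) = f (int j)"
    then show "i = j" using residue_eq_iff[OF res res, of i j] cycle_eq[OF cyc] by simp
  qed
  moreover have "(\<lambda>i. f (int i)) ` {..<2 * n} = range f"
  proof
    show "range f \<subseteq> (\<lambda>i. f (int i)) ` {..<2 * n}"
    proof
      fix x assume "x \<in> range f"
      then obtain i where i: "x = f i" by auto
      define k where "k = nat (i mod (2 * int n))"
      have k: "int k = i mod (2 * int n)" "k < 2 * n" using n by (auto simp: k_def nat_less_iff)
      have "i - int k = 2 * int n * (i div (2 * int n))" unfolding k by (rule minus_mod_eq_mult_div)
      then have "2 * int n dvd i - int k" by (metis dvd_triv_left)
      then have "x = f (int k)" using i cycle_eq[OF cyc] by simp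
      then show "x \<in> (\<lambda>i. f (int i)) ` {..<2 * n}" using k(2) by blast
    qed
  qed auto
  moreover have "{i, j} \<in> cycle_edges (2 * n) \<longleftrightarrow> {f (int i), f (int j)} \<in> induced_edges E (range f)"
    if "i < 2 * n" "j < 2 * n" for i j
    using that cycle_edge[OF cyc] residue_Suc_iff[OF res res]
    by (simp add: cycle_edges_iff induced_edges_def)
  ultimately show ?thesis using n
    unfolding cycle_labelling_def graph_iso_def bij_betw_def by auto
qed

lemma convex_even_cycle_range: "even_cycle n f \<Longrightarrow> convex_even_cycle V E (range f)"
  unfolding convex_even_cycle_def using cycle_convex labelling_of_even_cycle
  by (metis dvd_triv_left)

text \<open>Three consecutive vertices span two edges, which differ because the length is at least
  4; distinct convex even cycles cannot share both.\<close>

lemma even_cycles_meet: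
  assumes f: "even_cycle n f" and g: "even_cycle m g"
    and "f i \<in> range g" "f (i + 1) \<in> range g" "f (i + 2) \<in> range g"
  shows "range f = range g"
proof (rule ccontr)
  assume neq: "range f \<noteq> range g"
  have "edge (f i) (f (i + 1))" "edge (f (i + 1)) (f (i + 2))"
    using cycle_edge_Suc[OF f, of i] cycle_edge_Suc[OF f, of "i + 1"] by (auto simp: add.assoc)
  then have "{f i, f (i + 1)} \<in> induced_edges E (range f \<inter> range g)"
    "{f (i + 1), f (i + 2)} \<in> induced_edges E (range f \<inter> range g)"
    using assms by (auto simp: induced_edges_def)
  then have "{f i, f (i + 1)} = {f (i + 1), f (i + 2)}"
    using mediangle neq convex_even_cycle_range[OF f] convex_even_cycle_range[OF g]
    unfolding mediangle_def intersection_of_even_cycles_def by meson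
  then have "f i = f (i + 2)" by (auto simp: doubleton_eq_iff)
  then have "2 * int n dvd 2" using cycle_eq[OF f, of "i + 2" i] by simp
  then show False using cycle_length[OF f] by (auto dest: zdvd_imp_le)
qed

lemma even_cycle_length_le:
  assumes f: "even_cycle n f" and g: "even_cycle m g" and "range f \<subseteq> range g"
  shows "n \<le> m"
proof -
  obtain a b where "f 0 = g a" "f (0 + int n) = g b" using assms(3) by (meson imageE rangeI subsetD)
  then show ?thesis using cycle_dist[OF f, of n 0] cycle_dist_max[OF g, of a b] by simp
qed

text \<open>The two labellings may run in opposite directions, but the antipode is determined by its
  distance from the common vertex.\<close>

lemma even_cycle_opposite_eq:
  assumes f: "even_cycle n f" and g: "even_cycle m g" and "range f = range g" "f i = g j"
  shows "n = m" "f (i + int n) = g (j + int m)"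
proof -
  show nm: "n = m" using even_cycle_length_le[OF f g] even_cycle_length_le[OF g f] assms(3) by simp
  have "f (i + int n) \<in> range g" using assms(3) rangeI by metis
  then obtain b where b: "f (i + int n) = g b" by auto
  then have "dist (g j) (g b) = n" using cycle_dist[OF f, of n i] assms(4) by simp
  then show "f (i + int n) = g (j + int m)" using cycle_opposite[OF g] nm b by simp
qed

text \<open>The cycle condition with the labelling normalised: a shift puts \<open>z\<close> at
  label 0, and a reflection, if needed, puts \<open>x\<close> at label 1.\<close>

lemma cycle_cond:
  assumes "p \<in> V" "edge x z" "edge y z" "x \<noteq> y" "dist p z = dist p x + 1" "dist p y = dist p x"
  obtains n f where "even_cycle n f" "f 0 = z" "f 1 = x" "f (- 1) = y"
    "dist p z = dist p (f (int n)) + n"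
proof -
  have V: "x \<in> V" "y \<in> V" "z \<in> V" "dist x z = 1" "dist y z = 1"
    using assms edge_props dist_edge by auto
  have "\<exists>Y w. convex_even_cycle V E Y \<and> {{z, x}, {z, y}} \<subseteq> induced_edges E Y \<and>
           opposite_vertices E Y z w \<and> w \<in> graph_interval V E p x \<inter> graph_interval V E p y"
    using mediangle assms V unfolding mediangle_def cycle_condition_def by (metis (lifting))
  then obtain Y w where Y: "convex_even_cycle V E Y" "{{z, x}, {z, y}} \<subseteq> induced_edges E Y"
     "opposite_vertices E Y z w" "w \<in> graph_interval V E p x"
    by blast
  obtain N c i where c: "even N" "cycle_labelling E Y N c" "i < N"
    "z = c i" "w = c ((i + N div 2) mod N)" using Y(3) unfolding opposite_vertices_def by blast
  define g where "g = (\<lambda>i. c (nat (i mod int N)))"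
  define n where "n = N div 2"
  have "graph_convex V E Y" using Y(1) unfolding convex_even_cycle_def by simp
  note g = even_cycle_of_labelling[OF this c(2,1), folded g_def n_def]
  define f where "f = (\<lambda>k. g (k + int i))"
  have f: "even_cycle n f" unfolding f_def by (rule even_cycle_shift[OF g(1)])
  have rf: "range f = Y" unfolding g(2)[symmetric] f_def
    by (auto simp: image_iff) (metis diff_add_cancel)
  have f0: "f 0 = z" using c(3,4) by (simp add: f_def g_def)
  have fn: "f (int n) = w" unfolding f_def g_def c(5) n_def[symmetric]
    by (metis add.commute nat_int of_nat_add zmod_int)
  have "x \<in> Y" "y \<in> Y" using Y(2) by (auto simp: induced_edges_def)
  then obtain a b where ab: "x = f a" "y = f b" using rf by auto
  have "x = f 1 \<or> x = f (- 1)" "y = f 1 \<or> y = f (- 1)"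
    using cycle_neighbour[OF f, of 0 a] cycle_neighbour[OF f, of 0 b] f0 ab edge_sym assms by auto
  then consider "x = f 1" "y = f (- 1)" | "x = f (- 1)" "y = f 1" using assms(4) by blast
  then obtain h where h: "even_cycle n h" "h 0 = z" "h 1 = x" "h (-1) = y" "h (int n) = w"
  proof cases
    case 1 then show ?thesis using that f f0 fn by blast
  next
    case 2
    \<comment> \<open>Reflection at 0 keeps the antipode, since labels \<open>- n\<close> and
      \<open>n\<close> name the same vertex.\<close>
    have "2 * int n dvd - int n - int n" by simp
    then have "f (- int n) = f (int n)" using cycle_eq[OF f] by blast
    then show ?thesis using that[of "\<lambda>k. f (0 - k)"] even_cycle_reflect[OF f, of 0] 2 f0 fn by simp
  qed
  \<comment> \<open>The antipode \<open>w\<close> lies between \<open>p\<close> and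
    \<open>x\<close>, and it is \<open>n - 1\<close> steps away from \<open>x\<close> along the
    cycle.\<close>
  have "1 + int (n - 1) = int n" using cycle_length[OF f] by simp
  then have "dist w x = n - 1" using cycle_dist_rev[OF h(1), of "n - 1" 1] h by simp
  then have "dist p z = dist p w + n"
    using Y(4) cycle_length[OF f] assms(5) by (auto simp: graph_interval_def)
  then show thesis using that h by simp
qed

section \<open>Distance to a vertex along a convex even cycle\<close>

lemma cycle_lipschitz:
  assumes f: "even_cycle n f" and p: "p \<in> V"
  shows "dist p (f (i + int k)) \<le> dist p (f i) + k" "dist p (f i) \<le> dist p (f (i + int k)) + k"
  using dist_triangle[OF p cycle_V[OF f] cycle_V[OF f]] cycle_dist_le[OF f, of i k]
   dist_sym[of "f i" "f (i + int k)"] by (metis add_left_mono order_trans)+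

text \<open>The cycle condition at the strict local maximum \<open>f i\<close> yields a cycle
  sharing two edges with \<open>f\<close>, hence equal to it. So the antipode of \<open>f i\<close>
  is \<open>n\<close> levels lower, and the Lipschitz bounds force a linear descent on both
  sides.\<close>

lemma cycle_local_max:
  assumes f: "even_cycle n f" and p: "p \<in> V"
    and "dist p (f i) = dist p (f (i + 1)) + 1" "dist p (f i) = dist p (f (i - 1)) + 1"
    and "k \<le> n"
  shows "dist p (f (i + int k)) + k = dist p (f i)" "dist p (f (i - int k)) + k = dist p (f i)"
proof -
  have edges: "edge (f (i + 1)) (f i)" "edge (f (i - 1)) (f i)"
    by (auto simp: cycle_edge[OF f])
  have "f (i + 1) \<noteq> f (i - 1)"
    using cycle_eq[OF f, of "i + 1" "i - 1"] cycle_length[OF f] by (auto dest: zdvd_imp_le)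
  then obtain m g where g: "even_cycle m g" "g 0 = f i" "g 1 = f (i + 1)" "g (-1) = f (i - 1)"
    "dist p (f i) = dist p (g (int m)) + m"
    by (rule cycle_cond[OF p edges _ assms(3)]) (use assms(3,4) in auto)
  have "range g = range f" using even_cycles_meet[OF g(1) f, of "-1"] g by simp
  then have opp: "dist p (f i) = dist p (f (i + int n)) + n"
    using even_cycle_opposite_eq[OF g(1) f, of 0 i] g by simp
  show "dist p (f (i + int k)) + k = dist p (f i)"
    using cycle_lipschitz(2)[OF f p, of i k] cycle_lipschitz(1)[OF f p, of "i + int n - int (n - k)" "n - k"]
      cycle_lipschitz(2)[OF f p, of "i + int k" "n - k"] opp assms(5) by (simp add: algebra_simps)
  have "2 * int n dvd (i + int n) - (i - int n)" by simp
  then have "f (i - int n) = f (i + int n)" using cycle_eq[OF f] by metis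
  then show "dist p (f (i - int k)) + k = dist p (f i)"
    using cycle_lipschitz(1)[OF f p, of "i - int k" k] cycle_lipschitz(1)[OF f p, of "i - int n" "n - k"]
      opp assms(5) by (simp add: algebra_simps)
qed


section \<open>Triangles over an edge of a convex even cycle\<close>

text \<open>On the cycle \<open>z\<close> would have to be \<open>f (- 1)\<close>, which is not
  adjacent to \<open>f 1\<close> in a cycle of length at least 4.\<close>

lemma apex_notin:
  assumes f: "even_cycle n f" and z: "edge z (f 0)" "edge z (f 1)"
  shows "z \<notin> range f"
proof
  assume "z \<in> range f"
  then obtain j where j: "z = f j" by auto
  have n: "n \<ge> 2" by (rule cycle_length[OF f])
  have "f j = f 1 \<or> f j = f (- 1)" using cycle_neighbour[OF f, of 0 j] z(1) j edge_sym by auto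
  then have "edge (f (- 1)) (f 1)" using z(2) j edge_props[of "f 1" "f 1"] by auto
  then have "2 * int n dvd 1 \<or> 2 * int n dvd 3"
    unfolding cycle_edge[OF f] using dvd_minus_iff[of "2 * int n" 3] by auto
  then show False using n by (auto dest: zdvd_imp_le)
qed

text \<open>The route through \<open>f 1\<close> gives at most \<open>n\<close>; distance
  \<open>n - 1\<close> would put \<open>z\<close> on a geodesic from \<open>f 0\<close> to its
  antipode, hence on the cycle by convexity. The second claim is symmetric.\<close>

lemma apex_dist:
  assumes f: "even_cycle n f" and z: "edge z (f 0)" "edge z (f 1)"
  shows "dist z (f (int n)) = n" "dist z (f (int n + 1)) = n"
proof -
  have n: "n \<ge> 2" by (rule cycle_length[OF f])
  have zV: "z \<in> V" using edge_props z by blast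
  have d: "dist (f 0) (f (int n)) = n" "dist (f 1) (f (int n + 1)) = n"
    "dist (f 1) (f (int n)) = n - 1" "dist (f 0) (f (int n + 1)) = n - 1"
  proof -
    show "dist (f 0) (f (int n)) = n" using cycle_dist[OF f, of n 0] by simp
    show "dist (f 1) (f (int n + 1)) = n" using cycle_dist[OF f, of n 1] by (simp add: add.commute)
    have "1 + int (n - 1) = int n" using n by simp
    then show "dist (f 1) (f (int n)) = n - 1" using cycle_dist[OF f, of "n - 1" 1] by simp
    have "f (int n + 1 + int (n - 1)) = f 0" unfolding cycle_eq[OF f] using n by simp
    then show "dist (f 0) (f (int n + 1)) = n - 1" using cycle_dist_rev[OF f, of "n - 1" "int n + 1"] by simp
  qed
  have dz: "dist (f 0) z = 1" "dist (f 1) z = 1" using dist_edge z edge_sym by blast+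
  have "dist (f 0) z + dist z (f (int n)) \<noteq> dist (f 0) (f (int n))"
    using cycle_convexD[OF f zV] apex_notin[OF f z] by blast
  moreover have "dist (f 0) (f (int n)) \<le> dist (f 0) z + dist z (f (int n))"
    by (intro dist_triangle cycle_V[OF f] zV)
  moreover have "dist z (f (int n)) \<le> dist z (f 1) + dist (f 1) (f (int n))"
    by (intro dist_triangle cycle_V[OF f] zV)
  ultimately show "dist z (f (int n)) = n"
    using d dz n dist_sym[of z "f 1"] by linarith
  have "dist (f 1) z + dist z (f (int n + 1)) \<noteq> dist (f 1) (f (int n + 1))"
    using cycle_convexD[OF f zV] apex_notin[OF f z] by blast
  moreover have "dist (f 1) (f (int n + 1)) \<le> dist (f 1) z + dist z (f (int n + 1))"
    by (intro dist_triangle cycle_V[OF f] zV)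
  moreover have "dist z (f (int n + 1)) \<le> dist z (f 0) + dist (f 0) (f (int n + 1))"
    by (intro dist_triangle cycle_V[OF f] zV)
  ultimately show "dist z (f (int n + 1)) = n"
    using d dz n dist_sym[of z "f 0"] by linarith
qed

lemma apex_top:
  assumes f: "even_cycle n f" and z: "edge z (f 0)" "edge z (f 1)"
  obtains u where "edge u (f (int n))" "edge u (f (int n + 1))" "dist z u = n - 1"
proof -
  have "z \<in> V" using edge_props z by blast
  moreover have "dist z (f (int n)) = dist z (f (int n + 1))" using apex_dist[OF f z] by simp
  ultimately obtain u where "edge u (f (int n))" "edge u (f (int n + 1))" "dist z (f (int n)) = dist z u + 1"
    using triangle_cond[OF _ cycle_edge_Suc[OF f]] by metis
  then show thesis using that apex_dist[OF f z] by simp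
qed

text \<open>Seen from \<open>f n\<close>, the apex \<open>z\<close> lies one level above both
  \<open>f 1\<close> and its neighbour towards \<open>u\<close>, so the cycle condition applies at
  \<open>z\<close>. The resulting cycle follows \<open>f\<close> from \<open>f 1\<close> on, and can
  only be a square.\<close>

lemma apex_square_top:
  assumes f: "even_cycle n f" and z: "edge z (f 0)" "edge z (f 1)"
    and u: "edge u (f (int n))" "edge u (f (int n + 1))" "dist z u = n - 1"
  obtains s where "even_cycle 2 s" "s 0 = z" "s 1 = f 1" "s 2 = f 2" "dist (s 3) u = n - 2"
proof -
  have n: "n \<ge> 2" by (rule cycle_length[OF f])
  have V: "z \<in> V" "u \<in> V" using edge_props z u by blast+
  have "dist u z = Suc (n - 2)" using u(3) n dist_sym[of z u] by simp
  \<comment> \<open>First vertex after \<open>z\<close> on a geodesic to \<open>u\<close>; it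
    becomes \<open>s 3\<close>.\<close>
  then obtain a where a: "edge a z" "dist u a = n - 2" using pred_exists V by metis
  have aV: "a \<in> V" using a(1) edge_props by blast
  have da: "dist (f (int n)) a = n - 1"
    using dist_triangle[OF cycle_V[OF f] V(2) aV, of "int n"] dist_edge[OF u(1)] dist_sym[of "f (int n)" u]
      dist_edge_le[OF cycle_V[OF f] a(1), of "int n"] apex_dist(1)[OF f z] a(2) n dist_sym[of z "f (int n)"]
    by linarith
  have one: "1 + int (n - 1) = int n" using n by simp
  have d1: "dist (f (int n)) (f 1) = n - 1" using cycle_dist_rev[OF f, of "n - 1" 1] one by simp
  have dz: "dist (f (int n)) z = n" using apex_dist(1)[OF f z] dist_sym by metis
  \<comment> \<open>Otherwise \<open>f 1\<close> would be within \<open>n - 1\<close> of its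
    antipode \<open>f (n + 1)\<close>, a neighbour of \<open>u\<close>.\<close>
  have "a \<noteq> f 1"
  proof
    assume "a = f 1"
    then have "dist u (f 1) = n - 2" using a(2) by simp
    moreover have "dist (f 1) (f (1 + int n)) = n" using cycle_dist[OF f, of n 1] by simp
    moreover have "dist (f 1) (f (1 + int n)) \<le> dist (f 1) u + 1"
      using dist_edge_le[OF cycle_V[OF f] u(2), of 1] by (simp add: add.commute)
    ultimately show False using n dist_sym[of u "f 1"] by linarith
  qed
  then obtain l s where s: "even_cycle l s" "s 0 = z" "s 1 = f 1" "s (- 1) = a"
    "dist (f (int n)) z = dist (f (int n)) (s (int l)) + l"
    using cycle_cond[OF cycle_V[OF f] edge_sym[OF z(2)] a(1), of "int n"] d1 da dz n by auto
  have l: "l \<ge> 2" by (rule cycle_length[OF s(1)])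
  have ds: "dist (f 1) (s (1 + int k)) = k" if "k \<le> l" for k
    using cycle_dist[OF s(1) that, of 1] s(3) by simp
  \<comment> \<open>The arc of \<open>s\<close> from \<open>f 1\<close> to its bottom
    \<open>s l\<close> extends to a geodesic from \<open>f 1\<close> to \<open>f n\<close>, so
    convexity puts the arc on \<open>f\<close>.\<close>
  have geo: "s (1 + int k) \<in> range f" if "k < l" for k
  proof (rule cycle_convexD[OF f cycle_V[OF s(1)], of 1 _ "int n"])
    have "dist (s (1 + int k)) (s (1 + int k + int (l - 1 - k))) = l - 1 - k"
      using cycle_dist[OF s(1), of "l - 1 - k" "1 + int k"] by simp
    moreover have "1 + int k + int (l - 1 - k) = int l" using that by simp
    ultimately have "dist (s (1 + int k)) (s (int l)) = l - 1 - k" by simp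
    moreover have "dist (s (1 + int k)) (f (int n)) \<le> dist (s (1 + int k)) (s (int l)) + dist (s (int l)) (f (int n))"
      by (intro dist_triangle cycle_V[OF f] cycle_V[OF s(1)])
    moreover have "dist (f 1) (f (int n)) \<le> dist (f 1) (s (1 + int k)) + dist (s (1 + int k)) (f (int n))"
      by (intro dist_triangle cycle_V[OF f] cycle_V[OF s(1)])
    ultimately show "dist (f 1) (s (1 + int k)) + dist (s (1 + int k)) (f (int n)) = dist (f 1) (f (int n))"
      using ds[of k] that s(5) dz d1 dist_sym[of "f 1" "f (int n)"] dist_sym[of "f (int n)" "s (int l)"] by linarith
  qed
  have zs: "z \<in> range s" using s(2) by (metis rangeI)
  \<comment> \<open>A longer cycle would share three consecutive vertices with \<open>f\<close>, so
    equal it, but \<open>z\<close> is not on \<open>f\<close>.\<close>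
  have "l = 2"
  proof (rule ccontr)
    assume "l \<noteq> 2"
    then have "s 1 \<in> range f" "s 2 \<in> range f" "s 3 \<in> range f"
      using l geo[of 0] geo[of 1] geo[of 2] by simp_all
    then have "range s = range f" using even_cycles_meet[OF s(1) f, of 1] by simp
    then show False using zs apex_notin[OF f z] by simp
  qed
  then have sq: "even_cycle 2 s" using s(1) by simp
  have "s 2 \<in> range f" using geo[of 1] l by simp
  then obtain b where b: "s 2 = f b" by auto
  have "edge (f 1) (f b)" using cycle_edge_Suc[OF s(1), of 1] s(3) b by simp
  then have "f b = f 2 \<or> f b = f 0" using cycle_neighbour[OF f, of 1 b] by simp
  moreover have "f b \<noteq> f 0"
  proof
    assume "f b = f 0"
    then have "edge z (s 2)" using z b by simp
    then show False using cycle_edge[OF sq, of 0 2] s(2) by simp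
  qed
  ultimately have "s 2 = f 2" using b by simp
  moreover have "s 3 = s (- 1)" unfolding cycle_eq[OF sq] by simp
  ultimately show thesis using that[of s] sq s a dist_sym[of u a] by simp
qed

text \<open>
  The square erected over the edge \<open>f 1\<close>, \<open>f 2\<close> next to the triangle is itself adjacent to a
  triangle with apex \<open>f 0\<close>, which gives a square sharing two edges with the cycle.
\<close>

lemma apex_imp_square:
  assumes f: "even_cycle n f" and z: "edge z (f 0)" "edge z (f 1)"
  shows "n = 2"
proof -
  obtain u where u: "edge u (f (int n))" "edge u (f (int n + 1))" "dist z u = n - 1"
    using apex_top[OF f z] .
  obtain s where s: "even_cycle 2 s" "s 0 = z" "s 1 = f 1" "s 2 = f 2" using apex_square_top[OF f z u] .
  have y: "edge (f 0) (s 0)" "edge (f 0) (s 1)" using s z edge_sym cycle_edge_Suc[OF f, of 0] by auto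
  obtain v where v: "edge v (s (int 2))" "edge v (s (int 2 + 1))" "dist (f 0) v = 2 - 1"
    using apex_top[OF s(1) y] .
  obtain t where t: "even_cycle 2 t" "t 0 = f 0" "t 1 = s 1" "t 2 = s 2"
    using apex_square_top[OF s(1) y v] .
  have "range t = range f" using even_cycles_meet[OF t(1) f, of 0] t s by simp
  then show "n = 2" using even_cycle_opposite_eq(1)[OF f t(1), of 0 0] t by simp
qed

text \<open>For a square the two apexes \<open>z\<close> and \<open>u\<close> are adjacent. The
  square on the other side of the prism comes from \<open>apex_square_top\<close> for the reflected
  labelling, where \<open>dist (s 3) u = 0\<close> identifies its fourth vertex with
  \<open>u\<close>.\<close>

lemma apex_prism:
  assumes f: "even_cycle 2 f" and z: "edge z (f 0)" "edge z (f 1)"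
  obtains u g where "edge u (f 2)" "edge u (f 3)" "edge z u"
    "even_cycle 2 g" "g 0 = u" "g 1 = z" "g 2 = f 0" "g 3 = f 3"
proof -
  obtain u where u: "edge u (f 2)" "edge u (f 3)" "dist z u = 1"
    using apex_top[OF f z] by auto
  define h where "h = (\<lambda>i. f (1 - i))"
  have h: "even_cycle 2 h" unfolding h_def by (rule even_cycle_reflect[OF f])
  have h23: "h 2 = f 3" "h 3 = f 2" unfolding h_def by (simp_all add: cycle_eq[OF f])
  have zh: "edge z (h 0)" "edge z (h 1)" using z by (auto simp: h_def)
  have uh: "edge u (h (int 2))" "edge u (h (int 2 + 1))" "dist z u = 2 - 1" using u h23 by auto
  obtain s where s: "even_cycle 2 s" "s 0 = z" "s 1 = h 1" "s 2 = h 2" "dist (s 3) u = 2 - 2"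
    using apex_square_top[OF h zh uh] .
  have uV: "u \<in> V" using edge_props u by blast
  have s3: "s 3 = u" using s(5) dist_eq_0[OF cycle_V[OF s(1)] uV] by simp
  have g: "even_cycle 2 (\<lambda>i. s (i - 1))" using even_cycle_shift[OF s(1), of "-1"] by simp
  have "s (- 1) = s 3" by (simp add: cycle_eq[OF s(1)])
  then show thesis
    using that[OF u(1,2) _ g] s s3 h23 edge_props z(1) uV dist_eq_1[of z u] u(3) by (simp add: h_def)
qed

text \<open>Compare levels, meaning distances to \<open>p\<close>, in the prism over
  \<open>f\<close>. A descent from \<open>f 2\<close> to \<open>f 3\<close> gives either a square
  with a strict top whose antipode is too high, or two adjacent vertices two levels apart.\<close>

lemma plateau_opposite_le:
  assumes f: "even_cycle 2 f" and p: "p \<in> V" and eq: "dist p (f 0) = dist p (f 1)"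
  shows "dist p (f 2) \<le> dist p (f 3)"
proof (rule ccontr)
  assume "\<not> ?thesis"
  then have lt: "dist p (f 3) < dist p (f 2)" by simp
  have f30: "f (3 + 1) = f 0" by (simp add: cycle_eq[OF f])
  note e = cycle_edge_Suc[OF f, of 1] cycle_edge_Suc[OF f, of 2] cycle_edge_Suc[OF f, of 3, unfolded f30]
  obtain z where z: "edge z (f 0)" "edge z (f 1)" "dist p (f 0) = dist p z + 1"
    using triangle_cond[OF p cycle_edge_Suc[OF f, of 0]] eq by auto
  obtain u g where u: "edge u (f 2)" "edge u (f 3)" "edge z u"
    and g: "even_cycle 2 g" "g 0 = u" "g 1 = z" "g 2 = f 0" "g 3 = f 3"
    using apex_prism[OF f z(1,2)] .
  have lip: "dist p (f 2) \<le> dist p (f 1) + 1" "dist p (f 2) \<le> dist p (f 3) + 1"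
    "dist p (f 0) \<le> dist p (f 3) + 1" "dist p u \<le> dist p z + 1" "dist p (f 2) \<le> dist p u + 1"
    using dist_edge_le[OF p e(1)] dist_edge_ge[OF p e(2)] dist_edge_le[OF p e(3)]
      dist_edge_le[OF p u(3)] dist_edge_le[OF p u(1)] by simp_all
  show False
  proof (cases "dist p (f 2) = dist p (f 1) + 1")
    case True
    then have "dist p (f 3) = dist p (f 1)" using lip eq lt by linarith
    \<comment> \<open>Here \<open>f 2\<close> is a strict top of \<open>f\<close>, but its antipode
      \<open>f 0\<close> is only one level lower.\<close>
    then show False using cycle_local_max(1)[OF f p, of 2 2] True eq
      cycle_eq[OF f, of 4 0] by auto
  next
    case False
    then have f23: "dist p (f 2) = dist p (f 0)" "dist p (f 0) = dist p (f 3) + 1"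
      using lip lt eq by linarith+
    show False
    proof (cases "dist p u = dist p (f 0)")
      case True
      \<comment> \<open>Here \<open>u\<close> is a strict top of \<open>g\<close>, its neighbours
        \<open>z\<close> and \<open>f 3\<close> being one lower, but its antipode \<open>f 0\<close>
        is on the same level.\<close>
      have "g (- 1) = g 3" by (simp add: cycle_eq[OF g(1)])
      then show False using cycle_local_max(1)[OF g(1) p, of 0 2] True f23 z(3) g by auto
    next
      case False
      then have "dist p u = dist p (f 3)" using f23 lip z(3) by linarith
      \<comment> \<open>Both \<open>y\<close> and \<open>f 2\<close> are common neighbours of the
        edge \<open>u\<close>, \<open>f 3\<close>, hence adjacent, yet two levels apart.\<close>
      then obtain y where y: "edge y u" "edge y (f 3)" "dist p u = dist p y + 1"
        using triangle_cond[OF p u(2)] by metis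
      have "dist p (f 2) = dist p y + 2" using y f23 \<open>dist p u = dist p (f 3)\<close> by simp
      then have "f 2 \<noteq> y" by auto
      then have "edge (f 2) y"
        using no_K4_minus[OF u(2) edge_sym[OF u(1)] _ y(1,2)] e(2) by simp
      then show False using dist_edge_ge[OF p, of "f 2" y] \<open>dist p (f 2) = dist p y + 2\<close> by simp
    qed
  qed
qed

text \<open>The edge carries a triangle, so the cycle is a square;
  \<open>plateau_opposite_le\<close> for the labelling and for its reflection gives both
  inequalities.\<close>

lemma plateau_opposite:
  assumes f: "even_cycle n f" and p: "p \<in> V" and eq: "dist p (f i) = dist p (f (i + 1))"
  shows "n = 2" "dist p (f (i + 2)) = dist p (f (i + 3))"
proof -
  obtain z where "edge z (f i)" "edge z (f (i + 1))"
    using triangle_cond[OF p cycle_edge_Suc[OF f] eq] .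
  then show n: "n = 2" using apex_imp_square[OF even_cycle_shift[OF f, of i]] by (simp add: add.commute)
  then have f: "even_cycle 2 f" using f by simp
  have "dist p (f (i + 2)) \<le> dist p (f (i + 3))"
    using plateau_opposite_le[OF even_cycle_shift[OF f, of i] p] eq by (simp add: add.commute)
  moreover have "dist p (f (i - 1)) \<le> dist p (f (i - 2))"
    using plateau_opposite_le[OF even_cycle_reflect[OF f, of "i + 1"] p] eq by simp
  moreover have "f (i - 1) = f (i + 3)" "f (i - 2) = f (i + 2)" by (simp_all add: cycle_eq[OF f])
  ultimately show "dist p (f (i + 2)) = dist p (f (i + 3))" by simp
qed

text \<open>If some edge is constant, the cycle is a square with two opposite constant edges.
  Otherwise the maximum \<open>f a\<close> is strict and every opposite pair has sum
  \<open>2 * dist p (f a) - n\<close>.\<close>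

lemma opposite_dist_sum:
  assumes f: "even_cycle n f" and p: "p \<in> V"
  shows "dist p (f i) + dist p (f (i + int n)) = dist p (f (i + 1)) + dist p (f (i + 1 + int n))"
proof (cases "\<exists>j. dist p (f j) = dist p (f (j + 1))")
  case True
  then obtain j where j: "dist p (f j) = dist p (f (j + 1))" by blast
  note n = plateau_opposite(1)[OF f p j]
  then have f: "even_cycle 2 f" using f by simp
  note j2 = plateau_opposite(2)[OF f p j]
  have cases: "4 dvd i - j \<or> 4 dvd i - (j + 1) \<or> 4 dvd i - (j + 2) \<or> 4 dvd i - (j + 3)" by presburger
  have shift: "f (i + m) = f (k + m)" if "4 dvd i - k" for k m
    using that by (simp add: cycle_eq[OF f])
  have per: "f (j + 4) = f j" "f (j + 5) = f (j + 1)" "f (j + 6) = f (j + 2)"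
    by (simp_all add: cycle_eq[OF f])
  show ?thesis
    using cases shift[of _ 0] shift[of _ 1] shift[of _ 2] shift[of _ 3] per j j2 n
    by (auto simp: add.assoc)
next
  case False
  have n: "n \<ge> 2" by (rule cycle_length[OF f])
  have red: "\<exists>k<2 * n. f t = f (a + int k)" for t a
  proof -
    let ?k = "nat ((t - a) mod (2 * int n))"
    have k: "int ?k = (t - a) mod (2 * int n)" "?k < 2 * n" using n by (auto simp: nat_less_iff)
    have "(t - a) - int ?k = 2 * int n * ((t - a) div (2 * int n))" unfolding k by (rule minus_mod_eq_mult_div)
    then have "t - (a + int ?k) = 2 * int n * ((t - a) div (2 * int n))" by linarith
    then have "f t = f (a + int ?k)" unfolding cycle_eq[OF f] by (metis dvd_triv_left)
    then show ?thesis using k(2) by blast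
  qed
  \<comment> \<open>Periodicity bounds the distances, so a maximum is attained although labels range
    over all integers.\<close>
  let ?D = "range (\<lambda>j. dist p (f j))"
  have "?D \<subseteq> {..dist p (f 0) + 2 * n}"
  proof (intro image_subsetI)
    fix t
    obtain k where "k < 2 * n" "f t = f (0 + int k)" using red[of t 0] by blast
    then show "dist p (f t) \<in> {..dist p (f 0) + 2 * n}" using cycle_lipschitz(1)[OF f p, of 0 k] by simp
  qed
  then have fin: "finite ?D" by (rule finite_subset) simp
  obtain a where "Max ?D = dist p (f a)" using Max_in[OF fin] by auto
  then have a: "dist p (f t) \<le> dist p (f a)" for t using Max_ge[OF fin, of "dist p (f t)"] by auto
  have "dist p (f (a + 1)) \<noteq> dist p (f a)" "dist p (f (a - 1)) \<noteq> dist p (f a)"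
    using False by (metis, metis diff_add_cancel)
  moreover have "dist p (f a) \<le> dist p (f (a + 1)) + 1" "dist p (f a) \<le> dist p (f (a - 1)) + 1"
    using dist_edge_ge[OF p cycle_edge_Suc[OF f, of a]] dist_edge_le[OF p cycle_edge_Suc[OF f, of "a - 1"]] by simp_all
  ultimately have max: "dist p (f a) = dist p (f (a + 1)) + 1" "dist p (f a) = dist p (f (a - 1)) + 1"
    using a[of "a + 1"] a[of "a - 1"] by linarith+
  note lm = cycle_local_max[OF f p max]
  \<comment> \<open>One vertex of the pair is reached forwards from \<open>a\<close>, the other
    backwards, in \<open>n\<close> steps altogether.\<close>
  have "dist p (f t) + dist p (f (t + int n)) + n = 2 * dist p (f a)" for t
  proof -
    obtain k where k: "k < 2 * n" "f t = f (a + int k)" using red by blast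
    have kn: "f (t + int n) = f (a + int k + int n)" using k(2) by (simp add: cycle_eq[OF f])
    show ?thesis
    proof (cases "k \<le> n")
      case True
      have "f (a + int k + int n) = f (a - int (n - k))" using True by (simp add: cycle_eq[OF f])
      then show ?thesis using lm(1)[of k] lm(2)[of "n - k"] k kn True by simp
    next
      case False
      have e: "f (t + int n) = f (a + int (k - n))" "f t = f (a - int (2 * n - k))"
        unfolding k(2) kn using False k(1) by (simp_all add: cycle_eq[OF f])
      have le: "k - n \<le> n" "2 * n - k \<le> n" using False k(1) by simp_all
      show ?thesis unfolding e using lm(1)[OF le(1)] lm(2)[OF le(2)] k(1) False by linarith
    qed
  qed
  from this[of i] this[of "i + 1"] show ?thesis by simp
qed


section \<open>Parallel edges and gates in cliques\<close>

abbreviation parallel :: "('a set \<times> 'a set) set" where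
  "parallel \<equiv> elementary_parallel V E"

lemma parallel_triangle:
  assumes "edge x y" "edge y z" "edge x z"
    and "e \<in> E" "e \<subseteq> {x, y, z}" "e' \<in> E" "e' \<subseteq> {x, y, z}"
  shows "(e, e') \<in> parallel"
proof -
  define c where "c = (\<lambda>i::nat. if i = 0 then x else if i = 1 then y else z)"
  have three: "{..<3} = {0, 1, 2::nat}" by auto
  have ne: "x \<noteq> y" "y \<noteq> z" "x \<noteq> z" "{x, y, z} \<subseteq> V" using assms edge_props by auto
  have loop: "{v} \<notin> E" for v using edge_props[of v v] by auto
  have "bij_betw c {..<3} {x, y, z}"
    unfolding bij_betw_def three using ne by (auto simp: c_def inj_on_def)
  moreover have "\<forall>i\<in>{..<3}. \<forall>j\<in>{..<3}. {i, j} \<in> cycle_edges 3 \<longleftrightarrow> {c i, c j} \<in> induced_edges E {x, y, z}"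
  proof (intro ballI)
    fix i j :: nat assume "i \<in> {..<3}" "j \<in> {..<3}"
    then have ij: "i < 3" "j < 3" and "i \<in> {0, 1, 2}" "j \<in> {0, 1, 2}" by auto
    then show "{i, j} \<in> cycle_edges 3 \<longleftrightarrow> {c i, c j} \<in> induced_edges E {x, y, z}"
      unfolding cycle_edges_iff[OF ij] using assms loop
      by (auto simp: c_def induced_edges_def insert_commute)
  qed
  ultimately have "cycle_labelling E {x, y, z} 3 c"
    by (simp add: cycle_labelling_def graph_iso_def)
  then have "three_cycle V E {x, y, z}" using ne(4) unfolding three_cycle_def by blast
  then show ?thesis using assms(4-) unfolding elementary_parallel_def induced_edges_def by blast
qed

lemma parallel_opposite:
  assumes f: "even_cycle n f"
  shows "({f i, f (i + 1)}, {f (i + int n), f (i + 1 + int n)}) \<in> parallel"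
proof -
  define g where "g = (\<lambda>k. f (k + i))"
  have g: "even_cycle n g" unfolding g_def by (rule even_cycle_shift[OF f])
  have n: "n \<ge> 2" by (rule cycle_length[OF f])
  let ?c = "\<lambda>k. g (int k)"
  have "Suc n mod (2 * n) = Suc n" using n by simp
  then have "{f i, f (i + 1)} = {?c 0, ?c (Suc 0 mod (2 * n))}"
    "{f (i + int n), f (i + 1 + int n)} = {?c ((0 + (2 * n) div 2) mod (2 * n)), ?c (Suc (0 + (2 * n) div 2) mod (2 * n))}"
    using n by (simp_all add: g_def algebra_simps)
  then have "opposite_edges E (range g) {f i, f (i + 1)} {f (i + int n), f (i + 1 + int n)}"
    unfolding opposite_edges_def using labelling_of_even_cycle[OF g] n
    by (intro exI[of _ "2 * n"] exI[of _ ?c] exI[of _ 0]) auto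
  then show ?thesis using convex_even_cycle_range[OF g] unfolding elementary_parallel_def by blast
qed

lemma parallelE:
  assumes "(e, e') \<in> parallel"
  obtains (triangle) x y z where "edge x y" "edge y z" "edge x z" "e \<in> E" "e \<subseteq> {x, y, z}" "e' \<in> E" "e' \<subseteq> {x, y, z}"
  | (opposite) n f i where "even_cycle n f" "e = {f i, f (i + 1)}" "e' = {f (i + int n), f (i + 1 + int n)}"
proof -
  consider Y where "three_cycle V E Y" "e \<in> induced_edges E Y" "e' \<in> induced_edges E Y"
    | Y where "convex_even_cycle V E Y" "opposite_edges E Y e e'"
    using assms unfolding elementary_parallel_def by blast
  then show thesis
  proof cases
    case (1 Y)
    then obtain c where c: "cycle_labelling E Y 3 c" unfolding three_cycle_def by blast
    have three: "{..<3} = {0, 1, 2::nat}" by auto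
    have Y: "Y = {c 0, c 1, c 2}" using c
      unfolding cycle_labelling_def graph_iso_def bij_betw_def three by auto
    have iso: "{i, j} \<in> cycle_edges 3 \<longleftrightarrow> {c i, c j} \<in> induced_edges E Y" if "i < 3" "j < 3" for i j
      using c that unfolding cycle_labelling_def graph_iso_def by auto
    have "edge (c 0) (c 1)" "edge (c 1) (c 2)" "edge (c 0) (c 2)"
      using iso[of 0 1] iso[of 1 2] iso[of 0 2] by (auto simp: cycle_edges_iff induced_edges_def)
    then show thesis using triangle[of "c 0" "c 1" "c 2"] 1 Y by (auto simp: induced_edges_def)
  next
    case (2 Y)
    then obtain N c i where c: "even N" "cycle_labelling E Y N c" "i < N" "e = {c i, c (Suc i mod N)}"
      "e' = {c ((i + N div 2) mod N), c (Suc (i + N div 2) mod N)}"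
      unfolding opposite_edges_def by blast
    define f where "f = (\<lambda>i. c (nat (i mod int N)))"
    have "graph_convex V E Y" using 2 unfolding convex_even_cycle_def by simp
    note f = even_cycle_of_labelling(1)[OF this c(2,1), folded f_def]
    have fk: "f (int k) = c (k mod N)" for k by (simp add: f_def flip: zmod_int)
    have "e = {f (int i), f (int i + 1)}" using fk[of i] fk[of "Suc i"] c(3,4) by (simp add: add.commute)
    moreover have "e' = {f (int i + int (N div 2)), f (int i + 1 + int (N div 2))}"
      using fk[of "i + N div 2"] fk[of "Suc (i + N div 2)"] c(5) by (simp add: algebra_simps)
    ultimately show thesis using opposite f by blast
  qed
qed

lemma parallel_sym: "(e, e') \<in> parallel \<Longrightarrow> (e', e) \<in> parallel"
proof (erule parallelE)
  fix x y z assume "edge x y" "edge y z" "edge x z" "e \<in> E" "e \<subseteq> {x, y, z}" "e' \<in> E" "e' \<subseteq> {x, y, z}"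
  then show "(e', e) \<in> parallel" by (intro parallel_triangle[of x y z])
next
  fix n f i assume f: "even_cycle n f" and e: "e = {f i, f (i + 1)}" "e' = {f (i + int n), f (i + 1 + int n)}"
  have "f (i + int n + int n) = f i" "f (i + int n + 1 + int n) = f (i + 1)"
    by (simp_all add: cycle_eq[OF f])
  then show "(e', e) \<in> parallel" using parallel_opposite[OF f, of "i + int n"] e by (simp add: algebra_simps)
qed

lemma parallel_rtrancl_sym: "(e, e') \<in> parallel\<^sup>* \<Longrightarrow> (e', e) \<in> parallel\<^sup>*"
  using sym_rtrancl[of parallel] parallel_sym unfolding sym_def by blast

text \<open>An oriented form of the Djokovic relation: \<open>p\<close> is nearer to
  \<open>a\<close>, and \<open>q\<close> is nearer to \<open>b\<close>.\<close>

definition crossing :: "'a \<Rightarrow> 'a \<Rightarrow> 'a \<Rightarrow> 'a \<Rightarrow> bool" where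
  "crossing a b p q \<longleftrightarrow> dist a p < dist b p \<and> dist b q < dist a q"

lemma crossing_dist:
  assumes "edge a b" "edge p q" "crossing a b p q"
  shows "dist b p = dist a p + 1" "dist b q = dist a p" "dist a q = dist a p + 1"
proof -
  have V: "a \<in> V" "b \<in> V" "p \<in> V" "q \<in> V" using assms edge_props by auto
  have "dist b p \<le> dist a p + 1" "dist a q \<le> dist b q + 1"
    using dist_edge_le[OF V(3) assms(1)] dist_edge_ge[OF V(4) assms(1)] by (simp_all add: dist_sym)
  then show "dist b p = dist a p + 1" "dist b q = dist a p" "dist a q = dist a p + 1"
    using dist_edge_le[OF V(1) assms(2)] dist_edge_ge[OF V(2) assms(2)] assms(3)
    unfolding crossing_def by linarith+
qed

text \<open>From \<open>f i\<close> to \<open>f (i + 1)\<close> the distance to \<open>a\<close>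
  rises and that to \<open>b\<close> falls. By \<open>opposite_dist_sum\<close> both changes are
  reversed on the opposite edge, and adjacency of \<open>a\<close> and \<open>b\<close> fixes which
  one is nearer.\<close>

lemma crossing_opposite:
  assumes f: "even_cycle n f" and ab: "edge a b" and "crossing a b (f i) (f (i + 1))"
  shows "crossing a b (f (i + 1 + int n)) (f (i + int n))"
proof -
  have V: "a \<in> V" "b \<in> V" using edge_props[OF ab] by auto
  have "dist b (f j) \<le> dist a (f j) + 1" "dist a (f j) \<le> dist b (f j) + 1" for j
    using dist_edge_le[OF cycle_V[OF f] ab] dist_edge_ge[OF cycle_V[OF f] ab] by (simp_all add: dist_sym)
  from this[of "i + int n"] this[of "i + 1 + int n"] crossing_dist[OF ab cycle_edge_Suc[OF f] assms(3)]
    opposite_dist_sum[OF f V(1), of i] opposite_dist_sum[OF f V(2), of i]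
  have "dist a (f (i + 1 + int n)) < dist b (f (i + 1 + int n))" "dist b (f (i + int n)) < dist a (f (i + int n))"
    by linarith+
  then show ?thesis by (simp add: crossing_def)
qed

text \<open>Induction on the distance of \<open>p\<close> from \<open>a\<close>: a convex even cycle
  with top \<open>q\<close> carries \<open>p q\<close> to its opposite edge, which still crosses and
  is nearer. At distance 0 the edge is \<open>a b\<close> itself.\<close>

lemma crossing_imp_parallel:
  assumes ab: "edge a b" and "edge p q" "crossing a b p q"
  shows "({a, b}, {p, q}) \<in> parallel\<^sup>*"
  using assms(2,3)
proof (induction "dist a p" arbitrary: p q rule: less_induct)
  case less
  note d = crossing_dist[OF ab less.prems]
  have V: "a \<in> V" "b \<in> V" "p \<in> V" "q \<in> V" using ab less.prems edge_props by auto
  show ?case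
  proof (cases "dist a p")
    case 0
    then show ?thesis using d V dist_eq_0 by auto
  next
    case (Suc k)
    obtain r where r: "edge r q" "dist b r = k" using pred_exists[OF V(2,4)] d(2) Suc by metis
    \<comment> \<open>With \<open>r\<close> one step from \<open>q\<close> towards \<open>b\<close>,
      both \<open>p\<close> and \<open>r\<close> lie one level below \<open>q\<close> as seen from
      \<open>a\<close>.\<close>
    have ra: "dist a r = dist a p"
      using dist_edge_le[OF V(1) r(1)] dist_edge_ge[of r a b] ab edge_props[OF r(1)] d Suc r(2)
      by (simp add: dist_sym)
    have "p \<noteq> r" using d r(2) Suc by auto
    then obtain n f where f: "even_cycle n f" "f 0 = q" "f 1 = p" "f (- 1) = r"
      "dist a q = dist a (f (int n)) + n"
      by (rule cycle_cond[OF V(1) less.prems(1) r(1) _ d(3) ra])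
    \<comment> \<open>Reflected so that \<open>p q\<close> becomes the edge from label 0 to label 1;
      the new near end is the antipode of \<open>q\<close>.\<close>
    define g where "g = (\<lambda>i. f (1 - i))"
    have g: "even_cycle n g" unfolding g_def by (rule even_cycle_reflect[OF f(1)])
    have g01: "g 0 = p" "g 1 = q" using f by (auto simp: g_def)
    have gn: "g (0 + 1 + int n) = f (int n)" unfolding g_def cycle_eq[OF f(1)] by simp
    have cr: "crossing a b (g (0 + 1 + int n)) (g (0 + int n))"
      using crossing_opposite[OF g ab, of 0] less.prems g01 by simp
    have "dist a (g (0 + 1 + int n)) < dist a p" using gn f(5) d(3) cycle_length[OF g] by simp
    moreover have "edge (g (0 + 1 + int n)) (g (0 + int n))"
      using edge_sym[OF cycle_edge_Suc[OF g, of "int n"]] by (simp add: add.commute)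
    ultimately have "({a, b}, {g (0 + 1 + int n), g (0 + int n)}) \<in> parallel\<^sup>*"
      using less.hyps cr by blast
    moreover have "({g (0 + 1 + int n), g (0 + int n)}, {p, q}) \<in> parallel"
      using parallel_sym[OF parallel_opposite[OF g, of 0]] g01 by (simp add: insert_commute)
    ultimately show ?thesis by (rule rtrancl_into_rtrancl)
  qed
qed

text \<open>For an edge \<open>a b\<close> this is the unique maximal clique containing it.\<close>

definition clique :: "'a \<Rightarrow> 'a \<Rightarrow> 'a set" where
  "clique a b = {v. v = a \<or> v = b \<or> edge v a \<and> edge v b}"

text \<open>The choice made by \<open>ARG_MIN\<close> is harmless: \<open>gate_dist\<close> shows
  that the nearest vertex is unique.\<close>

definition gate :: "'a \<Rightarrow> 'a \<Rightarrow> 'a \<Rightarrow> 'a" where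
  "gate a b p = (ARG_MIN (dist p) v. v \<in> clique a b)"

section \<open>Gates in the clique of a fixed edge\<close>

context
  fixes a b assumes ab: "edge a b"
begin

lemma clique_edge: "v \<in> clique a b \<Longrightarrow> w \<in> clique a b \<Longrightarrow> v \<noteq> w \<Longrightarrow> edge v w"
  using ab no_K4_minus[OF ab] unfolding clique_def by (auto dest: edge_sym)

lemma clique_V: "v \<in> clique a b \<Longrightarrow> v \<in> V"
  using edge_props[OF ab] edge_props unfolding clique_def by auto

text \<open>Any further vertex of the clique and \<open>z\<close> are common neighbours of the edge
  \<open>v w\<close>, hence adjacent.\<close>

lemma clique_maximal:
  assumes "v \<in> clique a b" "w \<in> clique a b" "v \<noteq> w" "edge z v" "edge z w"
  shows "z \<in> clique a b"
proof -
  have "z = u \<or> edge z u" if "u \<in> clique a b" for u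
  proof (cases "u = v \<or> u = w \<or> z = u")
    case False
    then show ?thesis
      using no_K4_minus[OF clique_edge[OF assms(1-3)] assms(4,5), of u] clique_edge that assms by auto
  qed (use assms in auto)
  from this[of a] this[of b] show ?thesis by (auto simp: clique_def)
qed

lemma gate_in: "gate a b p \<in> clique a b"
  and gate_min: "v \<in> clique a b \<Longrightarrow> dist p (gate a b p) \<le> dist p v"
proof -
  have "a \<in> clique a b" by (simp add: clique_def)
  from arg_min_nat_lemma[of "\<lambda>v. v \<in> clique a b", OF this, of "dist p"]
  show "gate a b p \<in> clique a b" "v \<in> clique a b \<Longrightarrow> dist p (gate a b p) \<le> dist p v"
    unfolding gate_def by auto
qed

text \<open>A tie would, by the triangle condition, give a strictly nearer common neighbour of both
  vertices, which belongs to the clique by maximality.\<close>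

lemma gate_dist:
  assumes "p \<in> V" "v \<in> clique a b" "v \<noteq> gate a b p"
  shows "dist p v = dist p (gate a b p) + 1"
proof -
  let ?c = "gate a b p"
  have e: "edge ?c v" using clique_edge gate_in assms by metis
  have "dist p ?c \<noteq> dist p v"
  proof
    assume "dist p ?c = dist p v"
    then obtain z where z: "edge z ?c" "edge z v" "dist p ?c = dist p z + 1"
      using triangle_cond[OF assms(1) e] by metis
    then have "z \<in> clique a b" using clique_maximal[OF gate_in assms(2)] assms(3) by metis
    then show False using gate_min[of z p] z(3) by simp
  qed
  then show ?thesis using dist_edge_le[OF assms(1) e] gate_min[OF assms(2), of p] by simp
qed

text \<open>All clique vertices except the gate are equally far from \<open>p\<close>, so one strict
  inequality identifies the gate.\<close>

lemma gate_eqI: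
  assumes "p \<in> V" "c \<in> clique a b" "v \<in> clique a b" "dist p c < dist p v"
  shows "gate a b p = c"
  using gate_dist[OF assms(1,2)] gate_dist[OF assms(1,3)] assms(4) gate_min[OF assms(3), of p] by fastforce

lemma gate_neqI:
  assumes "p \<in> V" "q \<in> V" "c \<in> clique a b" "d \<in> clique a b" "crossing c d p q"
  shows "gate a b p \<noteq> gate a b q"
proof -
  have "gate a b p = c" "gate a b q = d"
    using gate_eqI[OF assms(1,3,4)] gate_eqI[OF assms(2,4,3)] assms(5)
    unfolding crossing_def by (simp_all add: dist_sym)
  then show "gate a b p \<noteq> gate a b q" using assms(5) by (auto simp: crossing_def)
qed

lemma gate_crossing:
  assumes "p \<in> V" "q \<in> V" "gate a b p \<noteq> gate a b q"
  shows "crossing (gate a b p) (gate a b q) p q"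
  using gate_dist[OF assms(1) gate_in, of q] gate_dist[OF assms(2) gate_in, of p] assms(3)
    unfolding crossing_def by (auto simp: dist_sym)

lemma clique_parallel:
  assumes "c \<in> clique a b" "d \<in> clique a b" "c \<noteq> d"
  shows "({a, b}, {c, d}) \<in> parallel\<^sup>*"
proof -
  have in_clique: "a \<in> clique a b" "b \<in> clique a b" by (simp_all add: clique_def)
  \<comment> \<open>Edges at \<open>a\<close> lie in a triangle with \<open>a b\<close>; a clique
    edge avoiding \<open>a\<close> lies in a triangle with an edge at \<open>a\<close>.\<close>
  have star: "({a, b}, {a, v}) \<in> parallel\<^sup>*" if "v \<in> clique a b" "v \<noteq> a" for v
  proof (cases "v = b")
    case False
    then have e: "edge a v" "edge b v"
      using that clique_edge[OF in_clique(1) that(1)] clique_edge[OF in_clique(2) that(1)] by simp_all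
    then have "({a, b}, {a, v}) \<in> parallel" using ab by (intro parallel_triangle[OF ab e(2,1)]) simp_all
    then show ?thesis by (rule r_into_rtrancl)
  qed simp
  show ?thesis
  proof (cases "a = c \<or> a = d")
    case True
    then show ?thesis
    proof
      assume "a = c" then show ?thesis using star[OF assms(2)] assms(3) by simp
    next
      assume "a = d" then show ?thesis using star[OF assms(1)] assms(3) by (simp add: insert_commute)
    qed
  next
    case False
    then have "edge a c" "edge c d" "edge a d"
      using clique_edge[OF in_clique(1) assms(1)] clique_edge[OF in_clique(1) assms(2)]
        clique_edge[OF assms] by simp_all
    then have "({a, c}, {c, d}) \<in> parallel" by (intro parallel_triangle[of a c d]) simp_all
    moreover have "({a, b}, {a, c}) \<in> parallel\<^sup>*" using star[OF assms(1)] False by auto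
    ultimately show ?thesis by (rule rtrancl_into_rtrancl[rotated])
  qed
qed

text \<open>If \<open>p\<close> and \<open>r\<close> had the same gate \<open>c\<close>, they would
  be at equal distance from \<open>c\<close>, with \<open>q\<close> one further. The triangle
  condition gives a common neighbour of \<open>p\<close> and \<open>r\<close> one level nearer,
  adjacent to \<open>q\<close> by \<open>no_K4_minus\<close> but two levels away from it.\<close>

lemma gate_triangle:
  assumes pq: "edge p q" and r: "edge r p" "edge r q" and neq: "gate a b p \<noteq> gate a b q"
  shows "gate a b r \<noteq> gate a b p"
proof
  assume eq: "gate a b r = gate a b p"
  let ?c = "gate a b p" and ?d = "gate a b q"
  have V: "p \<in> V" "q \<in> V" "r \<in> V" "?c \<in> V" using edge_props pq r clique_V[OF gate_in] by auto
  have cd: "edge ?c ?d" using clique_edge[OF gate_in gate_in] neq by simp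
  have cr: "crossing ?c ?d p q" "crossing ?c ?d r q"
    using gate_crossing[OF V(1,2) neq] gate_crossing[OF V(3,2)] eq neq by auto
  note d = crossing_dist[OF cd pq cr(1)] crossing_dist[OF cd r(2) cr(2)]
  obtain z where z: "edge z r" "edge z p" "dist ?c r = dist ?c z + 1"
    using triangle_cond[OF V(4) r(1)] d by auto
  have "z \<noteq> q" using z(3) d by auto
  then have "edge z q" using no_K4_minus[OF r(1) z(1,2)] pq r edge_sym by metis
  then show False using dist_edge_le[OF V(4), of z q] z(3) d by simp
qed

text \<open>In a triangle, two different gates force three by \<open>gate_triangle\<close>; in an
  even cycle, the edge between the gates crosses both opposite edges.\<close>

lemma gate_parallel:
  assumes "(e, e') \<in> parallel" "\<exists>p\<in>e. \<exists>q\<in>e. gate a b p \<noteq> gate a b q"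
  shows "\<exists>p\<in>e'. \<exists>q\<in>e'. gate a b p \<noteq> gate a b q"
  using assms(1)
proof (cases rule: parallelE)
  case (triangle x y z)
  obtain p q where pq: "p \<in> e" "q \<in> e" "gate a b p \<noteq> gate a b q" using assms(2) by blast
  then have "p \<in> {x, y, z}" "q \<in> {x, y, z}" using triangle(5) by auto
  then have "gate a b x \<noteq> gate a b y \<or> gate a b y \<noteq> gate a b z" using pq(3) by auto
  then have "gate a b x \<noteq> gate a b y \<and> gate a b y \<noteq> gate a b z \<and> gate a b x \<noteq> gate a b z"
    using gate_triangle triangle(1-3) edge_sym by metis
  moreover obtain p q where "e' = {p, q}" "edge p q" using edgeE[OF triangle(6)] .
  ultimately show ?thesis using triangle(7) edge_props[of p q] by auto
next
  case (opposite n f i)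
  note f = opposite(1)
  have neq: "gate a b (f i) \<noteq> gate a b (f (i + 1))" using assms(2) opposite(2) by auto
  have "gate a b (f (i + 1 + int n)) \<noteq> gate a b (f (i + int n))"
    using gate_neqI[OF cycle_V[OF f] cycle_V[OF f] gate_in gate_in]
      crossing_opposite[OF f clique_edge[OF gate_in gate_in neq]] gate_crossing[OF cycle_V[OF f] cycle_V[OF f] neq]
    by blast
  then show ?thesis using opposite(3) by auto
qed

lemma gate_left: "gate a b a = a" and gate_right: "gate a b b = b"
  using gate_eqI[of a a b] gate_eqI[of b b a] edge_props[OF ab] dist_edge[OF ab] dist_sym[of a b]
  by (auto simp: clique_def)

text \<open>Forwards, \<open>a b\<close> is parallel to the clique edge joining the two gates, and
  that edge is parallel to \<open>p q\<close>. Backwards, \<open>a\<close> and \<open>b\<close> are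
  their own gates, and \<open>gate_parallel\<close> propagates the difference.\<close>

lemma gate_neq_iff_parallel:
  assumes "edge p q"
  shows "gate a b p \<noteq> gate a b q \<longleftrightarrow> ({a, b}, {p, q}) \<in> parallel\<^sup>*"
proof
  assume neq: "gate a b p \<noteq> gate a b q"
  then show "({a, b}, {p, q}) \<in> parallel\<^sup>*"
    using clique_parallel[OF gate_in gate_in neq]
      crossing_imp_parallel[OF clique_edge[OF gate_in gate_in neq] assms] gate_crossing edge_props[OF assms]
    by (meson rtrancl_trans)
next
  assume "({a, b}, {p, q}) \<in> parallel\<^sup>*"
  then have "\<exists>x\<in>{p, q}. \<exists>y\<in>{p, q}. gate a b x \<noteq> gate a b y"
  proof (induction rule: rtrancl_induct)
    case base
    then show ?case using gate_left gate_right edge_props[OF ab] by auto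
  next
    case (step y z)
    then show ?case using gate_parallel by blast
  qed
  then show "gate a b p \<noteq> gate a b q" by auto
qed

end


section \<open>Hyperplanes\<close>

definition hyperplane :: "'a set \<Rightarrow> 'a set set" where
  "hyperplane e = {e' \<in> E. (e, e') \<in> parallel\<^sup>*}"

lemma hyperplanes_eq: "hyperplanes V E = hyperplane ` E"
  unfolding hyperplanes_def quotient_def hyperplane_def by auto

lemma hyperplane_self: "e \<in> E \<Longrightarrow> e \<in> hyperplane e"
  by (simp add: hyperplane_def)

lemma hyperplane_eq:
  assumes "e' \<in> hyperplane e" shows "hyperplane e' = hyperplane e"
  using assms parallel_rtrancl_sym[of e e'] unfolding hyperplane_def
  by (auto intro: rtrancl_trans)

lemma edge_in_hyperplane:
  "edge a b \<Longrightarrow> edge p q \<Longrightarrow> {p, q} \<in> hyperplane {a, b} \<longleftrightarrow> gate a b p \<noteq> gate a b q"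
  by (simp add: gate_neq_iff_parallel hyperplane_def)

text \<open>Outside the hyperplane every edge has ends with the same gate, so the gate is constant
  on components.\<close>

lemma connected_imp_gate_eq:
  assumes "edge a b" "(x, y) \<in> (adj (E - hyperplane {a, b}))\<^sup>*"
  shows "gate a b x = gate a b y"
  using assms(2)
proof (induction rule: rtrancl_induct)
  case (step y z)
  then have "edge y z" "{y, z} \<notin> hyperplane {a, b}" by (auto simp: adj_def)
  then show ?case using edge_in_hyperplane[OF assms(1)] step.IH by simp
qed simp

lemma components_equiv: "equiv V {(x, y). x \<in> V \<and> y \<in> V \<and> (x, y) \<in> (adj F)\<^sup>*}"
proof -
  have "sym (adj F)" by (auto simp: sym_def adj_def insert_commute)
  then have "sym ((adj F)\<^sup>*)" by (rule sym_rtrancl)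
  then show ?thesis
    unfolding equiv_def refl_on_def sym_def trans_def by (auto intro: rtrancl_trans)
qed

lemma separates_iff:
  assumes "x \<in> V" "y \<in> V"
  shows "separates V E J x y \<longleftrightarrow> (x, y) \<notin> (adj (E - J))\<^sup>*"
proof -
  let ?R = "{(x, y). x \<in> V \<and> y \<in> V \<and> (x, y) \<in> (adj (E - J))\<^sup>*}"
  have class_eq: "C = ?R `` {v}" if C: "C \<in> V // ?R" and v: "v \<in> C" for C v
  proof -
    obtain w where w: "C = ?R `` {w}" using C by (rule quotientE)
    then have "(w, v) \<in> ?R" using v by blast
    then show ?thesis unfolding w by (rule equiv_class_eq[OF components_equiv])
  qed
  have "separates V E J x y \<longleftrightarrow> ?R `` {x} \<noteq> ?R `` {y}"
  proof
    assume "separates V E J x y"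
    then obtain C D where CD: "C \<in> V // ?R" "D \<in> V // ?R" "C \<noteq> D" "x \<in> C" "y \<in> D"
      unfolding separates_def graph_components_def by blast
    then show "?R `` {x} \<noteq> ?R `` {y}" using class_eq[OF CD(1,4)] class_eq[OF CD(2,5)] by simp
  next
    assume neq: "?R `` {x} \<noteq> ?R `` {y}"
    have "?R `` {x} \<in> V // ?R" "?R `` {y} \<in> V // ?R" by (intro quotientI assms)+
    moreover have "x \<in> ?R `` {x}" "y \<in> ?R `` {y}" using assms by auto
    ultimately show "separates V E J x y"
      unfolding separates_def graph_components_def using neq by (intro bexI conjI)
  qed
  then show ?thesis using eq_equiv_class_iff[OF components_equiv, of x y "E - J"] assms by simp
qed

section \<open>Geodesics and the hyperplanes they cross\<close>

lemma dist_path_le: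
  assumes "\<forall>i<d. edge (g i) (g (Suc i))" "i \<le> j" "j \<le> d"
  shows "dist (g i) (g j) \<le> j - i"
proof (rule dist_le)
  show "(g i, g j) \<in> adj E ^^ (j - i)"
    unfolding relpow_fun_conv using assms by (intro exI[of _ "\<lambda>k. g (i + k)"]) (auto simp: adj_def)
qed

definition geodesic :: "(nat \<Rightarrow> 'a) \<Rightarrow> 'a \<Rightarrow> 'a \<Rightarrow> bool" where
  "geodesic g x y \<longleftrightarrow> g 0 = x \<and> g (dist x y) = y \<and>
     (\<forall>i<dist x y. edge (g i) (g (Suc i))) \<and>
     (\<forall>i\<le>dist x y. dist x (g i) = i \<and> dist (g i) y = dist x y - i \<and> g i \<in> V)"

lemma geodesicD:
  assumes "geodesic g x y"
  shows "g 0 = x" "g (dist x y) = y" "\<And>i. i < dist x y \<Longrightarrow> edge (g i) (g (Suc i))"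
    "\<And>i. i \<le> dist x y \<Longrightarrow> dist x (g i) = i" "\<And>i. i \<le> dist x y \<Longrightarrow> dist (g i) y = dist x y - i"
    "\<And>i. i \<le> dist x y \<Longrightarrow> g i \<in> V"
  using assms by (simp_all add: geodesic_def)

lemma geodesic_exists:
  assumes "x \<in> V" "y \<in> V"
  obtains g where "geodesic g x y"
proof -
  let ?d = "dist x y"
  obtain g where g: "g 0 = x" "g ?d = y" "\<forall>i<?d. edge (g i) (g (Suc i))"
    using dist_walk[OF assms] unfolding relpow_fun_conv adj_def by auto
  have V: "g i \<in> V" if "i \<le> ?d" for i
  proof (cases "i = ?d")
    case False
    then show ?thesis using g(3) edge_props that by (metis le_neq_implies_less)
  qed (use g assms in simp)
  \<comment> \<open>The two parts of the walk give upper bounds; the triangle inequality makes them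
    exact.\<close>
  have "dist x (g i) = i \<and> dist (g i) y = ?d - i" if "i \<le> ?d" for i
    using dist_path_le[OF g(3), of 0 i] dist_path_le[OF g(3), of i ?d] that g(1,2)
      dist_triangle[OF assms(1) V[OF that] assms(2)] by auto
  then have "geodesic g x y" using g V by (simp add: geodesic_def)
  then show thesis by (rule that)
qed

text \<open>For an edge on a geodesic from \<open>x\<close> to \<open>y\<close>, the gate of
  \<open>x\<close> is \<open>a\<close> and that of \<open>y\<close> is \<open>b\<close>.\<close>

lemma separates_geodesic_edge:
  assumes "edge a b" "x \<in> V" "y \<in> V" "dist x b = dist x a + 1" "dist a y = dist b y + 1"
  shows "(x, y) \<notin> (adj (E - hyperplane {a, b}))\<^sup>*"
proof
  assume "(x, y) \<in> (adj (E - hyperplane {a, b}))\<^sup>*"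
  moreover have "gate a b x = a" "gate a b y = b"
    using gate_eqI[OF assms(1,2), of a b] gate_eqI[OF assms(1,3), of b a] assms(4,5)
    by (auto simp: clique_def dist_sym)
  ultimately show False using connected_imp_gate_eq[OF assms(1)] edge_props[OF assms(1)] by auto
qed

lemma path_avoiding:
  assumes "\<And>i. i < d \<Longrightarrow> edge (g i) (g (Suc i))" "\<And>i. i < d \<Longrightarrow> {g i, g (Suc i)} \<notin> J"
  shows "(g 0, g d) \<in> (adj (E - J))\<^sup>*"
proof -
  have "(g 0, g d) \<in> adj (E - J) ^^ d"
    unfolding relpow_fun_conv using assms by (intro exI[of _ g]) (auto simp: adj_def)
  then show ?thesis by (rule relpow_imp_rtrancl)
qed

text \<open>If \<open>z\<close> between \<open>x\<close> and \<open>y\<close> left the component, a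
  geodesic from \<open>x\<close> to \<open>z\<close> would use an edge of \<open>J\<close>. That
  edge also lies on a geodesic from \<open>x\<close> to \<open>y\<close>, so \<open>J\<close> would
  separate them.\<close>

lemma component_convex:
  assumes J: "J \<in> hyperplanes V E" and C: "C \<in> graph_components V (E - J)"
  shows "graph_convex V E C"
proof -
  let ?R = "{(x, y). x \<in> V \<and> y \<in> V \<and> (x, y) \<in> (adj (E - J))\<^sup>*}"
  obtain v where v: "v \<in> V" "C = ?R `` {v}"
    using C unfolding graph_components_def by (auto elim: quotientE)
  have CV: "C \<subseteq> V" using v by auto
  have conn: "(x, y) \<in> (adj (E - J))\<^sup>*" if "x \<in> C" "y \<in> C" for x y
    using quotient_eq_iff[OF components_equiv C[unfolded graph_components_def] C[unfolded graph_components_def] that]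
    by simp
  have closed: "z \<in> C" if "x \<in> C" "z \<in> V" "(x, z) \<in> (adj (E - J))\<^sup>*" for x z
    using that v by (auto intro: rtrancl_trans)
  have between: "z \<in> C" if x: "x \<in> C" and y: "y \<in> C" and z: "z \<in> V" and d: "dist x y = dist x z + dist z y" for x y z
  proof (rule ccontr)
    assume "z \<notin> C"
    have xy: "x \<in> V" "y \<in> V" using x y CV by auto
    obtain g where "geodesic g x z" using geodesic_exists[OF xy(1) z] .
    note g = geodesicD[OF this]
    have "(x, z) \<notin> (adj (E - J))\<^sup>*" using closed[OF x z] \<open>z \<notin> C\<close> by blast
    then obtain i where i: "i < dist x z" "{g i, g (Suc i)} \<in> J"
      using path_avoiding[of "dist x z" g J] g(1-3) by auto
    have J_eq: "J = hyperplane {g i, g (Suc i)}"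
      using J i(2) hyperplane_eq unfolding hyperplanes_eq by blast
    \<comment> \<open>Since \<open>z\<close> is between \<open>x\<close> and \<open>y\<close>,
      vertices before \<open>z\<close> have the distances to \<open>y\<close> of vertices on a
      geodesic to \<open>y\<close>.\<close>
    have gy: "dist (g k) y = dist x y - k" if "k \<le> dist x z" for k
      using dist_triangle[OF g(6)[OF that] z xy(2)] dist_triangle[OF xy(1) g(6)[OF that] xy(2)]
        g(4,5)[OF that] d that by linarith
    have "(x, y) \<notin> (adj (E - J))\<^sup>*"
      unfolding J_eq using i(1) g(3,4) gy d by (intro separates_geodesic_edge xy) auto
    then show False using conn[OF x y] by blast
  qed
  have "graph_interval V E x y \<subseteq> C" if "x \<in> C" "y \<in> C" for x y
  proof
    fix z assume "z \<in> graph_interval V E x y"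
    then have "z \<in> V \<and> dist x y = dist x z + dist z y" unfolding graph_interval_def by (rule CollectD)
    then show "z \<in> C" using between[OF that] by blast
  qed
  then show ?thesis using CV unfolding graph_convex_def by blast
qed

lemma two_components:
  assumes "J \<in> hyperplanes V E"
  shows "\<exists>C \<in> graph_components V (E - J). \<exists>D \<in> graph_components V (E - J). C \<noteq> D"
proof -
  obtain a b where ab: "edge a b" "J = hyperplane {a, b}"
    using assms edgeE unfolding hyperplanes_eq by (metis imageE)
  have V: "a \<in> V" "b \<in> V" using edge_props[OF ab(1)] by auto
  have "separates V E J a b"
    unfolding separates_iff[OF V] ab(2)
    using dist_edge[OF ab(1)] by (intro separates_geodesic_edge ab V) simp_all
  then show ?thesis unfolding separates_def by blast
qed

text \<open>The separating hyperplanes are exactly those of the edges of a geodesic, and these are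
  pairwise distinct. Finiteness is stated too, since \<open>card\<close> of an infinite set is
  0.\<close>

lemma dist_eq_card_separating:
  assumes V: "x \<in> V" "y \<in> V"
  shows "finite {J \<in> hyperplanes V E. separates V E J x y}"
    and "dist x y = card {J \<in> hyperplanes V E. separates V E J x y}"
proof -
  let ?d = "dist x y"
  obtain g where "geodesic g x y" using geodesic_exists[OF V] .
  note g = geodesicD[OF this]
  define H where "H = (\<lambda>i. hyperplane {g i, g (Suc i)})"
  have H_sep: "(x, y) \<notin> (adj (E - H i))\<^sup>*" if "i < ?d" for i
    unfolding H_def using g that by (intro separates_geodesic_edge V) auto
  have sep: "{J \<in> hyperplanes V E. separates V E J x y} = H ` {..<?d}"
  proof (intro equalityI subsetI)
    fix J assume "J \<in> {J \<in> hyperplanes V E. separates V E J x y}"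
    then have J: "J \<in> hyperplanes V E" "(x, y) \<notin> (adj (E - J))\<^sup>*" using separates_iff[OF V] by auto
    then obtain i where i: "i < ?d" "{g i, g (Suc i)} \<in> J"
      using path_avoiding[of ?d g J] g(1-3) by auto
    then have "J = H i" using J hyperplane_eq unfolding hyperplanes_eq H_def by blast
    then show "J \<in> H ` {..<?d}" using i by blast
  next
    fix J assume "J \<in> H ` {..<?d}"
    then obtain i where i: "i < ?d" "J = H i" by auto
    then show "J \<in> {J \<in> hyperplanes V E. separates V E J x y}"
      using H_sep g(3) separates_iff[OF V] unfolding hyperplanes_eq H_def by auto
  qed
  have H_neq: "H i \<noteq> H j" if "i < j" "j < ?d" for i j
  proof
    assume eq: "H i = H j"
    have ei: "edge (g i) (g (Suc i))" and ej: "edge (g j) (g (Suc j))" using g(3) that by auto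
    have path: "\<forall>i<?d. edge (g i) (g (Suc i))" using g(3) by blast
    have gd: "dist (g i) (g k) = k - i" if "i \<le> k" "k \<le> ?d" for i k
      using dist_path_le[OF path that] dist_triangle[OF V(1) g(6) g(6), of i k] that g(4)[of i] g(4)[of k]
      by simp
    \<comment> \<open>All later vertices have the same gate for the \<open>i\<close>-th edge, so no
      later edge belongs to \<open>H i\<close>.\<close>
    have "gate (g i) (g (Suc i)) (g k) = g (Suc i)" if "Suc i \<le> k" "k \<le> ?d" for k
      using gate_eqI[OF ei g(6)[OF that(2)], of "g (Suc i)" "g i"] gd[of i k] gd[of "Suc i" k] that
      by (auto simp: clique_def dist_sym)
    then have "{g j, g (Suc j)} \<notin> H i"
      unfolding H_def edge_in_hyperplane[OF ei ej] using that by simp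
    then show False using eq hyperplane_self[OF ej] by (simp add: H_def)
  qed
  have "inj_on H {..<?d}"
    using H_neq by (auto simp: inj_on_def) (metis linorder_neqE_nat)
  then show "finite {J \<in> hyperplanes V E. separates V E J x y}"
    and "dist x y = card {J \<in> hyperplanes V E. separates V E J x y}"
    unfolding sep by (simp_all add: card_image)
qed

end

theorem theorem1p5:
  fixes V :: "'a set" and E :: "'a set set"
  assumes "mediangle V E"
  shows "(\<forall>J \<in> hyperplanes V E.
            (\<exists>C \<in> graph_components V (E - J). \<exists>D \<in> graph_components V (E - J). C \<noteq> D) \<and>
            (\<forall>C \<in> graph_components V (E - J). graph_convex V E C)) \<and>
         (\<forall>x \<in> V. \<forall>y \<in> V.
            finite {J \<in> hyperplanes V E. separates V E J x y} \<and>
            graph_dist E x y = card {J \<in> hyperplanes V E. separates V E J x y})"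
proof -
  interpret mediangle_graph V E using assms by unfold_locales
  show ?thesis using two_components component_convex dist_eq_card_separating by blast
qed

end
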